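(* Let $x_0\in\mathbb{R}^n$ with $Ax_0\in E_i\setminus E_{i-1}$ for some integer $i$ with $2\le i\le m$. Then there exists a constant $C>0$ such that, with $c_0=\lim_{t\to0^+}t^{-\mathcal N}\det D_t>0$, $$p(t,x_0,x_0)=\frac{t^{-\mathcal N/2}}{(2\pi)^{n/2}\sqrt{c_0}}\exp\!\Big(-\frac{C+O(t)}{t^{2i-3}}\Big),\qquad t\to0^+.$$
   Context: Let $n\ge1$, $1\le k\le n$, let $A$ be a real $n\times n$ matrix and $B$ a real $n\times k$ matrix of rank $k$. Assume the Kalman condition: there is a minimal integer $m\ge1$ with $\mathrm{rank}[B,AB,\dots,A^{m-1}B]=n$. For $i\ge1$ let $E_i\subset\mathbb{R}^n$ be the span of the columns of $B,AB,\dots,A^{i-1}B$, let $E_0=\{0\}$, $k_i=\dim E_i$, $d_i=k_i-k_{i-1}$, and $\mathcal N:=\sum_{i=1}^m(2i-1)d_i$. For $t\in\mathbb{R}$ put $\Gamma_t:=\int_0^t e^{-\tau A}BB^{T}e^{-\tau A^{T}}\,d\tau$ and $D_t:=e^{tA}\Gamma_te^{tA^{T}}$; these are invertible for $t\neq0$. The heat kernel is $$p(t,x,y)=\frac{\exp\!\big(-\tfrac12(y-e^{tA}x)^{T}D_t^{-1}(y-e^{tA}x)\big)}{(2\pi)^{n/2}\sqrt{\det D_t}}.$$ *)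

theory Defs
  imports "HOL-Analysis.Analysis" "HOL-Library.Landau_Symbols"
begin

fun mpow :: "real^'n^'n \<Rightarrow> nat \<Rightarrow> real^'n^'n" where
  "mpow A 0 = mat 1"
| "mpow A (Suc k) = A ** mpow A k"

definition mexp :: "real \<Rightarrow> real^'n^'n \<Rightarrow> real^'n^'n" where
  "mexp t A = (\<Sum>k. (t ^ k / fact k) *\<^sub>R mpow A k)"

definition Espace :: "real^'n^'n \<Rightarrow> real^'k^'n \<Rightarrow> nat \<Rightarrow> (real^'n) set" where
  "Espace A B i = span (\<Union>j<i. columns (mpow A j ** B))"

definition kdim :: "real^'n^'n \<Rightarrow> real^'k^'n \<Rightarrow> nat \<Rightarrow> nat" where
  "kdim A B i = dim (Espace A B i)"

definition Nexp :: "real^'n^'n \<Rightarrow> real^'k^'n \<Rightarrow> nat \<Rightarrow> nat" where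
  "Nexp A B m = (\<Sum>i=1..m. (2*i - 1) * (kdim A B i - kdim A B (i - 1)))"

definition Gam :: "real^'n^'n \<Rightarrow> real^'k^'n \<Rightarrow> real \<Rightarrow> real^'n^'n" where
  "Gam A B t = (if 0 \<le> t then integral {0..t}
       (\<lambda>\<tau>. mexp (-\<tau>) A ** B ** transpose B ** mexp (-\<tau>) (transpose A))
     else - integral {t..0}
       (\<lambda>\<tau>. mexp (-\<tau>) A ** B ** transpose B ** mexp (-\<tau>) (transpose A)))"

definition Dmat :: "real^'n^'n \<Rightarrow> real^'k^'n \<Rightarrow> real \<Rightarrow> real^'n^'n" where
  "Dmat A B t = mexp t A ** Gam A B t ** mexp t (transpose A)"

definition heat_kernel :: "real^'n^'n \<Rightarrow> real^'k^'n \<Rightarrow> real \<Rightarrow> real^'n \<Rightarrow> real^'n \<Rightarrow> real" where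
  "heat_kernel A B t x y =
     (let v = y - mexp t A *v x
      in exp (-(1/2) * (v \<bullet> (matrix_inv (Dmat A B t) *v v)))
         / ((2*pi) powr (real CARD('n) / 2) * sqrt (det (Dmat A B t))))"

end

theory Submission
  imports Defs
begin

text \<open>Choose a basis \<open>e\<^sub>j\<close> adapted to the flag \<open>E\<^sub>1 \<subseteq> E\<^sub>2 \<subseteq> \<dots>\<close>, with \<open>e\<^sub>j\<close> in the
  \<open>(p\<^sub>j + 1)\<close>-st space and orthogonal to the \<open>p\<^sub>j\<close>-th. The Taylor series of \<open>e\<^sub>j \<bullet> e\<^sup>-\<^sup>t\<^sup>A B\<close> then
  starts at order \<open>t ^ p\<^sub>j\<close>, so that in this basis, rescaled by \<open>t ^ -p\<^sub>j\<close>, the Gramian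
  \<open>\<Gamma>\<^sub>t\<close> becomes \<open>t (G\<^sub>0 + O(t))\<close> with \<open>G\<^sub>0\<close> positive definite; this gives the determinant, because
  \<open>Nexp\<close> is the sum of the \<open>2 p\<^sub>j + 1\<close>. Conjugating by \<open>e\<^sup>-\<^sup>t\<^sup>A\<close>, the quadratic form of \<open>D\<^sub>t\<close> is that of
  \<open>\<Gamma>\<^sub>t\<close> at \<open>e\<^sup>-\<^sup>t\<^sup>A x\<^sub>0 - x\<^sub>0\<close>. Since \<open>A x\<^sub>0\<close> lies in \<open>E\<^sub>i\<close>, the same rescaling turns this vector into
  \<open>t ^ (2 - i) (z + O(t))\<close>, where \<open>z \<noteq> 0\<close> because \<open>A x\<^sub>0\<close> is not in the previous space. Hence the form
  is \<open>t ^ (3 - 2 i) (z \<bullet> G\<^sub>0\<^sup>-\<^sup>1 z + O(t))\<close>.\<close>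

section \<open>Matrix exponentials\<close>

lemma mpow_add: "mpow A (a + b) = mpow A a ** mpow A b"
  by (induction a) (simp_all add: matrix_mul_assoc)

lemma mpow_commute: "A ** mpow A k = mpow A k ** A"
  using mpow_add[of A k 1] by simp

lemma mpow_transpose: "mpow (transpose A) k = transpose (mpow A k)"
  by (induction k) (simp_all add: matrix_transpose_mul mpow_commute transpose_mat)

text \<open>With \<open>K\<close> the sum of the absolute values of all entries of \<open>A\<close>,
  induction bounds every entry of the \<open>k\<close>-th power by \<open>K ^ k\<close>; adding up
  the entries bounds the norm. The geometric growth makes the exponential series absolutely
  summable.\<close>

lemma mpow_norm_bound:
  fixes A :: "real^'n^'n"
  obtains c K :: real where "\<And>k. norm (mpow A k) \<le> c * K ^ k"
proof
  define K where "K = (\<Sum>a\<in>UNIV. \<Sum>b\<in>UNIV. \<bar>A $ a $ b\<bar>)"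
  have row: "(\<Sum>b\<in>UNIV. \<bar>A $ a $ b\<bar>) \<le> K" for a
    unfolding K_def by (rule member_le_sum) (auto intro: sum_nonneg)
  have K: "0 \<le> K" unfolding K_def by (intro sum_nonneg) auto
  have entry: "\<bar>mpow A k $ i $ j\<bar> \<le> K ^ k" for i j k
  proof (induction k arbitrary: i j)
    case 0
    then show ?case by (simp add: mat_def)
  next
    case (Suc k)
    have "\<bar>mpow A (Suc k) $ i $ j\<bar> \<le> (\<Sum>l\<in>UNIV. \<bar>A $ i $ l\<bar> * \<bar>mpow A k $ l $ j\<bar>)"
      unfolding mpow.simps matrix_matrix_mult_def by (simp flip: abs_mult)
    also have "\<dots> \<le> (\<Sum>l\<in>UNIV. \<bar>A $ i $ l\<bar> * K ^ k)"
      by (intro sum_mono mult_left_mono Suc.IH) auto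
    also have "\<dots> = (\<Sum>l\<in>UNIV. \<bar>A $ i $ l\<bar>) * K ^ k"
      by (simp only: sum_distrib_right)
    also have "\<dots> \<le> K * K ^ k"
      using K by (intro mult_right_mono row) auto
    finally show ?case by simp
  qed
  fix k
  have "norm (mpow A k) \<le> (\<Sum>i\<in>UNIV. norm (mpow A k $ i))"
    by (simp add: norm_vec_def L2_set_le_sum)
  also have "\<dots> \<le> (\<Sum>i\<in>UNIV. \<Sum>j\<in>UNIV. \<bar>mpow A k $ i $ j\<bar>)"
    by (intro sum_mono norm_le_l1_cart)
  also have "\<dots> \<le> (\<Sum>i\<in>(UNIV::'n set). \<Sum>j\<in>(UNIV::'n set). K ^ k)"
    by (intro sum_mono entry)
  finally show "norm (mpow A k) \<le> (real CARD('n) * real CARD('n)) * K ^ k" by (simp add: mult.assoc)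
qed

lemma mexp_norm_summable: "summable (\<lambda>k. norm ((t ^ k / fact k) *\<^sub>R mpow A k))"
proof -
  obtain c K where b: "\<And>k. norm (mpow A k) \<le> c * K ^ k" using mpow_norm_bound by blast
  have "summable (\<lambda>k. c * ((\<bar>t\<bar> * K) ^ k /\<^sub>R fact k))"
    by (intro summable_mult summable_exp_generic)
  moreover have "norm (norm ((t ^ k / fact k) *\<^sub>R mpow A k)) \<le> c * ((\<bar>t\<bar> * K) ^ k /\<^sub>R fact k)" for k
  proof -
    have "norm (norm ((t ^ k / fact k) *\<^sub>R mpow A k)) = \<bar>t\<bar> ^ k / fact k * norm (mpow A k)"
      by (simp add: power_abs)
    also have "\<dots> \<le> \<bar>t\<bar> ^ k / fact k * (c * K ^ k)"
      by (intro mult_left_mono b) simp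
    also have "\<dots> = c * ((\<bar>t\<bar> * K) ^ k /\<^sub>R fact k)"
      by (simp add: power_mult_distrib divide_inverse mult_ac)
    finally show ?thesis .
  qed
  ultimately show ?thesis by (rule summable_comparison_test'[where N = 0])
qed

lemma mexp_sums: "(\<lambda>k. (t ^ k / fact k) *\<^sub>R mpow A k) sums mexp t A"
  unfolding mexp_def by (rule summable_sums[OF summable_norm_cancel[OF mexp_norm_summable]])

text \<open>Reduces the matrix series to scalar power series in \<open>t\<close>. It is applied to
  the entries of a matrix and to the forms \<open>u \<bullet> (X *v y)\<close>.\<close>

lemma mexp_linear_image:
  fixes L :: "real^'n^'n \<Rightarrow> real"
  assumes "bounded_linear L"
  shows "(\<lambda>k. L (mpow A k) / fact k * t ^ k) sums L (mexp t A)"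
    and "summable (\<lambda>k. \<bar>L (mpow A k) / fact k * t ^ k\<bar>)"
proof -
  interpret bounded_linear L by fact
  have L: "L ((t ^ k / fact k) *\<^sub>R mpow A k) = L (mpow A k) / fact k * t ^ k" for k
    unfolding scaleR by simp
  show "(\<lambda>k. L (mpow A k) / fact k * t ^ k) sums L (mexp t A)"
    using sums[OF mexp_sums[of t A]] unfolding L .
  obtain C where C: "\<And>x. norm (L x) \<le> norm x * C" using bounded by blast
  show "summable (\<lambda>k. \<bar>L (mpow A k) / fact k * t ^ k\<bar>)"
  proof (rule summable_comparison_test'[where N = 0])
    show "summable (\<lambda>k. norm ((t ^ k / fact k) *\<^sub>R mpow A k) * C)"
      by (intro summable_mult2 mexp_norm_summable)
    show "norm \<bar>L (mpow A k) / fact k * t ^ k\<bar> \<le> norm ((t ^ k / fact k) *\<^sub>R mpow A k) * C" for k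
      using C[of "(t ^ k / fact k) *\<^sub>R mpow A k"] unfolding L real_norm_def abs_abs .
  qed
qed

lemma bounded_linear_entry: "bounded_linear (\<lambda>X::real^'m^'n. X $ i $ j)"
  by (intro bounded_linear_compose[OF bounded_linear_vec_nth] bounded_linear_vec_nth)

lemma mexp_entry:
  fixes A :: "real^'n^'n"
  shows "(\<lambda>k. mpow A k $ i $ j / fact k * t ^ k) sums (mexp t A $ i $ j)"
    and "summable (\<lambda>k. \<bar>mpow A k $ i $ j / fact k * t ^ k\<bar>)"
  using mexp_linear_image[OF bounded_linear_entry[of i j], of A t] by auto

lemma mexp_transpose: "mexp t (transpose A) = transpose (mexp t A)"
proof -
  have "mexp t (transpose A) $ i $ j = transpose (mexp t A) $ i $ j" for i j
  proof (rule sums_unique2[OF mexp_entry(1)])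
    show "(\<lambda>k. mpow (transpose A) k $ i $ j / fact k * t ^ k) sums (transpose (mexp t A) $ i $ j)"
      using mexp_entry(1)[of A j i t] unfolding mpow_transpose by (simp add: transpose_def)
  qed
  then show ?thesis by (simp add: vec_eq_iff)
qed

lemma mexp_0: "mexp 0 A = mat 1"
proof -
  have "(\<lambda>k. (0 ^ k / fact k) *\<^sub>R mpow A k) = (\<lambda>k. if k = 0 then mat 1 else 0)"
    by (auto simp: fun_eq_iff)
  then have "(\<lambda>k. (0 ^ k / fact k) *\<^sub>R mpow A k) sums mat 1"
    using sums_single[of 0 "\<lambda>_. mat 1"] by simp
  then show ?thesis by (rule sums_unique2[OF mexp_sums])
qed

text \<open>Entry by entry this is a Cauchy product of scalar series: summing over the inner index
  \<open>l\<close> recombines two powers into \<open>mpow A k\<close>, and the binomial theorem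
  collects the coefficients into \<open>(s + t) ^ k\<close>.\<close>

lemma mexp_add: "mexp s A ** mexp t A = mexp (s + t) A"
proof -
  have "(mexp s A ** mexp t A) $ i $ j = mexp (s + t) A $ i $ j" for i j
  proof -
    let ?a = "\<lambda>l k. mpow A k $ i $ l / fact k * s ^ k"
    let ?b = "\<lambda>l k. mpow A k $ l $ j / fact k * t ^ k"
    have "(\<lambda>k. \<Sum>r\<le>k. ?a l r * ?b l (k - r)) sums (mexp s A $ i $ l * mexp t A $ l $ j)" for l
      using Cauchy_product_sums[of "?a l" "?b l"] mexp_entry(2)[of A i l s] mexp_entry(2)[of A l j t]
        sums_unique[OF mexp_entry(1)[of A i l s]] sums_unique[OF mexp_entry(1)[of A l j t]]
      by simp
    then have "(\<lambda>k. \<Sum>l\<in>UNIV. \<Sum>r\<le>k. ?a l r * ?b l (k - r)) sums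
        (\<Sum>l\<in>UNIV. mexp s A $ i $ l * mexp t A $ l $ j)"
      by (intro sums_sum)
    moreover have "(\<Sum>l\<in>UNIV. \<Sum>r\<le>k. ?a l r * ?b l (k - r)) = mpow A k $ i $ j / fact k * (s + t) ^ k" for k
    proof -
      have "(\<Sum>l\<in>UNIV. ?a l r * ?b l (k - r)) =
          mpow A k $ i $ j / fact k * (of_nat (k choose r) * s ^ r * t ^ (k - r))" if "r \<le> k" for r
      proof -
        have "(\<Sum>l\<in>UNIV. ?a l r * ?b l (k - r)) =
            (mpow A r ** mpow A (k - r)) $ i $ j * (s ^ r * t ^ (k - r)) / (fact r * fact (k - r))"
          unfolding matrix_matrix_mult_def by (simp add: sum_distrib_left sum_divide_distrib mult_ac)
        then show ?thesis
          using that by (simp add: binomial_fact flip: mpow_add)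
      qed
      then show ?thesis
        by (subst sum.swap) (simp add: binomial_ring sum_distrib_left)
    qed
    ultimately have "(\<lambda>k. mpow A k $ i $ j / fact k * (s + t) ^ k) sums ((mexp s A ** mexp t A) $ i $ j)"
      unfolding matrix_matrix_mult_def by simp
    then show ?thesis by (rule sums_unique2[OF _ mexp_entry(1)])
  qed
  then show ?thesis by (simp add: vec_eq_iff)
qed

lemma mexp_minus: "mexp (-t) A ** mexp t A = mat 1"
  by (simp add: mexp_add mexp_0)

lemma continuous_mexp_linear_image:
  fixes L :: "real^'n^'n \<Rightarrow> real"
  assumes "bounded_linear L"
  shows "isCont (\<lambda>t. L (mexp t A)) t"
proof -
  have "L (mexp t A) = (\<Sum>k. L (mpow A k) / fact k * t ^ k)" for t
    by (rule sums_unique[OF mexp_linear_image(1)[OF assms]])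
  moreover have "isCont (\<lambda>t. \<Sum>k. L (mpow A k) / fact k * t ^ k) t"
    by (rule isCont_powser_converges_everywhere)
       (rule sums_summable[OF mexp_linear_image(1)[OF assms]])
  ultimately show ?thesis by simp
qed

lemma isCont_mexp_uminus:
  fixes L :: "real^'n^'n \<Rightarrow> real"
  assumes "bounded_linear L"
  shows "isCont (\<lambda>t. L (mexp (-t) A)) t"
  by (rule isCont_o2[OF _ continuous_mexp_linear_image[OF assms]]) simp

section \<open>Positive definite matrices\<close>

lemma matrix_inv_right_left:
  assumes "invertible D"
  shows "D ** matrix_inv D = mat 1" "matrix_inv D ** D = mat 1"
  using someI_ex[of "\<lambda>X. D ** X = mat 1 \<and> X ** D = mat 1"] assms
  unfolding invertible_def matrix_inv_def by auto

lemma matrix_inv_vector_eq: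
  fixes D :: "real^'n^'n"
  assumes "invertible D" "D *v y = v"
  shows "matrix_inv D *v v = y"
  using assms matrix_inv_right_left(2)[of D] by (metis matrix_vector_mul_assoc matrix_vector_mul_lid)

lemma matrix_inv_mult_vector:
  fixes D :: "real^'n^'n"
  assumes "invertible D"
  shows "D *v (matrix_inv D *v v) = v"
  by (simp add: matrix_vector_mul_assoc matrix_inv_right_left(1)[OF assms])

lemma det_nonzero_if_trivial_kernel:
  fixes M :: "real^'n^'n"
  assumes "\<And>x. M *v x = 0 \<Longrightarrow> x = 0"
  shows "det M \<noteq> 0"
  using assms unfolding invertible_det_nz[symmetric] invertible_left_inverse matrix_left_invertible_ker
  by blast

text \<open>Let \<open>y\<close> solve \<open>transpose P *v y = matrix_inv D *v v\<close>. Then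
  \<open>P ** D ** transpose P\<close> sends \<open>y\<close> to \<open>P *v v\<close>, so both
  sides equal \<open>v \<bullet> (transpose P *v y)\<close>.\<close>

lemma inverse_quadratic_form_congruence:
  fixes D P :: "real^'n^'n"
  assumes D: "invertible D" and P: "invertible P"
  shows "v \<bullet> (matrix_inv D *v v) =
    (P *v v) \<bullet> (matrix_inv (P ** D ** transpose P) *v (P *v v))"
proof -
  define u where "u = matrix_inv D *v v"
  have Du: "D *v u = v"
    unfolding u_def by (rule matrix_inv_mult_vector[OF D])
  have PT: "invertible (transpose P)" using P by (simp add: invertible_det_nz)
  define y where "y = matrix_inv (transpose P) *v u"
  have Py: "transpose P *v y = u"
    unfolding y_def by (rule matrix_inv_mult_vector[OF PT])
  have "(P ** D ** transpose P) *v y = P *v v"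
    using Du Py by (simp flip: matrix_vector_mul_assoc)
  then have "matrix_inv (P ** D ** transpose P) *v (P *v v) = y"
    by (intro matrix_inv_vector_eq invertible_mult D P PT)
  moreover have "(P *v v) \<bullet> y = v \<bullet> (transpose P *v y)"
    by (metis dot_lmul_matrix transpose_matrix_vector transpose_transpose inner_commute)
  ultimately show ?thesis using Py u_def by simp
qed

text \<open>On the segment from the identity to \<open>G\<close> the quadratic form stays positive,
  so no matrix on it is singular. The determinant starts at 1 and cannot change sign, by the
  intermediate value theorem.\<close>

lemma positive_definite_det_pos:
  fixes G :: "real^'n^'n"
  assumes pos: "\<And>x. x \<noteq> 0 \<Longrightarrow> 0 < x \<bullet> (G *v x)"
  shows "0 < det G"
proof (rule ccontr)
  assume neg: "\<not> 0 < det G"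
  let ?H = "\<lambda>s::real. (1 - s) *\<^sub>R mat 1 + s *\<^sub>R G"
  have "continuous_on {0..1} (\<lambda>s. det (?H s))"
    unfolding det_def by (intro continuous_intros)
  moreover have "det (?H 0) = 1" "det (?H 1) = det G" by simp_all
  ultimately obtain s where s: "0 \<le> s" "s \<le> 1" "det (?H s) = 0"
    using IVT2'[of "\<lambda>s. det (?H s)" 1 0 0] neg by auto
  then obtain x where x: "x \<noteq> 0" "?H s *v x = 0"
    using det_nonzero_if_trivial_kernel by blast
  have "x \<bullet> (?H s *v x) = (1 - s) * (x \<bullet> x) + s * (x \<bullet> (G *v x))"
    by (simp add: matrix_vector_mult_add_rdistrib scaleR_matrix_vector_assoc[symmetric] inner_add_right)
  moreover have "\<dots> > 0"
  proof (cases "s = 0")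
    case False
    then show ?thesis using s pos[OF x(1)] by (intro add_nonneg_pos) auto
  qed (use x in simp)
  ultimately show False using x(2) by simp
qed

lemma positive_definite_inverse_pos:
  fixes G :: "real^'n^'n"
  assumes pos: "\<And>x. x \<noteq> 0 \<Longrightarrow> 0 < x \<bullet> (G *v x)" and "z \<noteq> 0"
  shows "0 < z \<bullet> (matrix_inv G *v z)"
proof -
  have inv: "invertible G"
    using positive_definite_det_pos[OF pos] by (simp add: invertible_det_nz)
  define u where "u = matrix_inv G *v z"
  have Gu: "G *v u = z"
    unfolding u_def by (rule matrix_inv_mult_vector[OF inv])
  have "u \<noteq> 0" using Gu \<open>z \<noteq> 0\<close> by auto
  from pos[OF this] show ?thesis unfolding Gu by (simp add: u_def inner_commute)
qed

text \<open>Pairing with \<open>b r\<close> gives a scalar polynomial that vanishes on a whole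
  interval, so all its coefficients are 0, among them \<open>b r \<bullet> b r\<close>.\<close>

lemma vanishing_polynomial_vector:
  fixes b :: "nat \<Rightarrow> 'a::real_inner"
  assumes "\<And>s. s \<in> {0..1::real} \<Longrightarrow> (\<Sum>r\<le>n. s ^ r *\<^sub>R b r) = 0" and "r \<le> n"
  shows "b r = 0"
proof -
  have "b r \<bullet> b r = 0"
  proof (rule ccontr)
    assume "b r \<bullet> b r \<noteq> 0"
    then have "finite {s::real. (\<Sum>k\<le>n. (b k \<bullet> b r) * s ^ k) = 0}"
      using \<open>r \<le> n\<close> unfolding polyfun_finite_roots by blast
    moreover have "{0..1} \<subseteq> {s::real. (\<Sum>k\<le>n. (b k \<bullet> b r) * s ^ k) = 0}"
    proof safe
      fix s :: real assume "s \<in> {0..1}"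
      then have "(\<Sum>k\<le>n. s ^ k *\<^sub>R b k) \<bullet> b r = 0" using assms(1) by simp
      then show "(\<Sum>k\<le>n. (b k \<bullet> b r) * s ^ k) = 0"
        by (simp add: inner_sum_left mult.commute)
    qed
    ultimately show False
      using infinite_Icc[of "0::real" 1] finite_subset by (metis zero_less_one)
  qed
  then show ?thesis by simp
qed

text \<open>The quadratic form of this matrix is the integral over \<open>s \<in> [0, 1]\<close> of
  \<open>\<parallel>\<Sum>j. x\<^sub>j s ^ p\<^sub>j a\<^sub>j\<parallel>\<close> squared.\<close>

lemma moment_gram_matrix_pos:
  fixes a :: "'n::finite \<Rightarrow> real^'k" and p :: "'n \<Rightarrow> nat" and x :: "real^'n"
  assumes indep: "\<And>x. (\<And>r. (\<Sum>j | p j = r. x $ j *\<^sub>R a j) = 0) \<Longrightarrow> x = 0" and "x \<noteq> 0"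
  shows "0 < x \<bullet> ((\<chi> j l. (a j \<bullet> a l) / real (p j + p l + 1)) *v x)"
proof -
  let ?v = "\<lambda>s::real. \<Sum>j\<in>UNIV. (s ^ p j * x $ j) *\<^sub>R a j"
  let ?q = "x \<bullet> ((\<chi> j l. (a j \<bullet> a l) / real (p j + p l + 1)) *v x)"
  have exp: "?v s \<bullet> ?v s = (\<Sum>j\<in>UNIV. \<Sum>l\<in>UNIV. (x $ j * x $ l * (a j \<bullet> a l)) * s ^ (p j + p l))" for s
    by (simp add: inner_sum_left inner_sum_right power_add sum_distrib_left mult_ac inner_commute)
  have mono: "((\<lambda>s::real. s ^ k) has_integral (1 / real (k + 1))) {0..1}" for k
  proof -
    have "((\<lambda>s::real. s ^ k) has_integral (1 ^ Suc k / real (Suc k) - 0 ^ Suc k / real (Suc k))) {0..1}"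
    proof (rule fundamental_theorem_of_calculus)
      fix s :: real
      have "((\<lambda>s. s ^ Suc k / real (Suc k)) has_real_derivative (real (Suc k) * s ^ k) / real (Suc k)) (at s within {0..1})"
        by (intro derivative_eq_intros refl) auto
      then show "((\<lambda>s. s ^ Suc k / real (Suc k)) has_vector_derivative s ^ k) (at s within {0..1})"
        by (simp add: has_real_derivative_iff_has_vector_derivative del: of_nat_Suc)
    qed simp
    then show ?thesis by simp
  qed
  have "((\<lambda>s. ?v s \<bullet> ?v s) has_integral
      (\<Sum>j\<in>UNIV. \<Sum>l\<in>UNIV. (x $ j * x $ l * (a j \<bullet> a l)) * (1 / real (p j + p l + 1)))) {0..1}"
    unfolding exp by (intro has_integral_sum has_integral_mult_right mono) auto
  moreover have "(\<Sum>j\<in>UNIV. \<Sum>l\<in>UNIV. (x $ j * x $ l * (a j \<bullet> a l)) * (1 / real (p j + p l + 1))) = ?q"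
    by (simp add: inner_vec_def[of x] matrix_vector_mult_def sum_distrib_left mult_ac)
  ultimately have int: "((\<lambda>s. ?v s \<bullet> ?v s) has_integral ?q) {0..1}" by simp
  have cont: "continuous_on {0..1} (\<lambda>s. ?v s \<bullet> ?v s)" by (intro continuous_intros)
  have "0 \<le> ?q" using has_integral_nonneg[OF int] by simp
  moreover have "?q \<noteq> 0"
  proof
    assume "?q = 0"
    then have i0: "((\<lambda>s. ?v s \<bullet> ?v s) has_integral 0) (cbox 0 1)" using int by simp
    have zero: "?v s = 0" if "s \<in> {0..1}" for s
    proof -
      have "?v s \<bullet> ?v s = 0"
        using has_integral_0_cbox_imp_0[OF _ _ i0, of s] cont that by simp
      then show ?thesis by simp
    qed
    define n where "n = Max (range p)"
    have n: "p j \<le> n" for j unfolding n_def by simp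
    \<comment> \<open>Grouping the indices by exponent makes \<open>?v\<close> a polynomial in
      \<open>s\<close> whose coefficient at \<open>s ^ r\<close> is the sum occurring in
      \<open>indep\<close>.\<close>
    define b where "b = (\<lambda>r. \<Sum>j | p j = r. x $ j *\<^sub>R a j)"
    have "?v s = (\<Sum>r\<le>n. s ^ r *\<^sub>R b r)" for s
    proof -
      have "?v s = (\<Sum>r\<le>n. \<Sum>j | j \<in> UNIV \<and> p j = r. (s ^ p j * x $ j) *\<^sub>R a j)"
        using n by (intro sum.group[symmetric]) auto
      then show ?thesis by (simp add: b_def scaleR_sum_right)
    qed
    then have "b r = 0" if "r \<le> n" for r
      using vanishing_polynomial_vector[where n = n and b = b and r = r] zero that by simp
    moreover have "b r = 0" if "\<not> r \<le> n" for r
    proof -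
      have "{j. p j = r} = {}" using n that by auto
      then show ?thesis unfolding b_def by simp
    qed
    ultimately have "x = 0" by (intro indep) (auto simp: b_def)
    then show False using \<open>x \<noteq> 0\<close> by simp
  qed
  ultimately show ?thesis by simp
qed

section \<open>Bases adapted to the flag\<close>

lemma subspace_Espace: "subspace (Espace A B r)"
  unfolding Espace_def by (rule subspace_span)

lemma Espace_0: "Espace A B 0 = {0}"
  by (simp add: Espace_def)

lemma Espace_mono: "r \<le> s \<Longrightarrow> Espace A B r \<subseteq> Espace A B s"
  unfolding Espace_def by (intro span_mono UN_mono) auto

lemma column_matrix_mult: "column c (A ** M) = A *v column c M"
  by (simp add: column_def matrix_matrix_mult_def matrix_vector_mult_def)

lemma column_in_Espace: "k < r \<Longrightarrow> column c (mpow A k ** B) \<in> Espace A B r"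
  unfolding Espace_def by (intro span_base) (auto simp: columns_def)

text \<open>\<open>A\<close> carries a generating column at power \<open>j\<close> to one at power
  \<open>Suc j\<close>. Iterated, this locates the Taylor coefficients of the drift in the
  flag.\<close>

lemma Espace_mult:
  assumes "x \<in> Espace A B r"
  shows "A *v x \<in> Espace A B (Suc r)"
proof -
  have "A *v x \<in> (*v) A ` Espace A B r" using assms by blast
  also have "\<dots> = span ((*v) A ` (\<Union>j<r. columns (mpow A j ** B)))"
    unfolding Espace_def by (simp add: linear_span_image)
  also have "\<dots> \<subseteq> Espace A B (Suc r)"
  proof (rule span_minimal[OF _ subspace_Espace], clarify)
    fix j y assume "j < r" "y \<in> columns (mpow A j ** B)"
    then obtain c where "y = column c (mpow A j ** B)" by (auto simp: columns_def)
    then have "A *v y = column c (mpow A (Suc j) ** B)"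
      by (simp add: column_matrix_mult matrix_vector_mul_assoc flip: matrix_mul_assoc)
    with \<open>j < r\<close> show "A *v y \<in> Espace A B (Suc r)" by (metis Suc_mono column_in_Espace)
  qed
  finally show ?thesis .
qed

lemma Espace_mpow_mult: "x \<in> Espace A B r \<Longrightarrow> mpow A k *v x \<in> Espace A B (r + k)"
  by (induction k) (auto simp flip: matrix_vector_mul_assoc intro: Espace_mult)

lemma transpose_mult_nth: "(transpose M *v u) $ c = column c M \<bullet> u"
  by (simp add: matrix_vector_mult_def transpose_def column_def inner_vec_def)

text \<open>The space of index \<open>Suc r\<close> is generated by the one of index
  \<open>r\<close> and the columns of \<open>mpow A r ** B\<close>; the second hypothesis is
  orthogonality to those columns.\<close>

lemma orthogonal_Espace_Suc:
  assumes "\<And>x. x \<in> Espace A B r \<Longrightarrow> u \<bullet> x = 0"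
    and "transpose (mpow A r ** B) *v u = 0"
    and "x \<in> Espace A B (Suc r)"
  shows "u \<bullet> x = 0"
proof -
  have "orthogonal u y" if y: "y \<in> columns (mpow A k ** B)" and k: "k < Suc r" for y k
  proof -
    obtain c where c: "y = column c (mpow A k ** B)" using y by (auto simp: columns_def)
    show ?thesis
    proof (cases "k = r")
      case True
      then show ?thesis
        using c assms(2) transpose_mult_nth[of "mpow A r ** B" u c]
        by (simp add: orthogonal_def inner_commute)
    next
      case False
      then have "k < r" using k by simp
      then show ?thesis
        unfolding c orthogonal_def by (intro assms(1) column_in_Espace)
    qed
  qed
  then have "orthogonal u x"
    by (intro orthogonal_to_span[OF assms(3)[unfolded Espace_def]]) blast
  then show ?thesis by (simp add: orthogonal_def)
qed

text \<open>By induction on \<open>r\<close>, an orthogonal set spanning \<open>E r\<close> is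
  extended to one spanning \<open>E (Suc r)\<close>. The function \<open>q\<close> records the stage
  at which a vector entered, and orthogonality to the span of the earlier vectors gives
  orthogonality to \<open>E (q s)\<close>.\<close>

lemma adapted_orthogonal_set:
  fixes E :: "nat \<Rightarrow> 'a::euclidean_space set"
  assumes sub: "\<And>r. subspace (E r)" and mono: "\<And>r s. r \<le> s \<Longrightarrow> E r \<subseteq> E s" and E0: "E 0 = {0}"
  shows "\<exists>S q. pairwise orthogonal S \<and> 0 \<notin> S \<and> span S = E r \<and>
    (\<forall>s\<in>S. q s < r \<and> s \<in> E (Suc (q s)) \<and> (\<forall>u\<in>E (q s). s \<bullet> u = 0)) \<and>
    (\<forall>k\<le>r. card {s\<in>S. q s < k} = dim (E k))"
proof (induction r)
  case 0
  show ?case by (rule exI[of _ "{}"]) (auto simp: E0)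
next
  case (Suc r)
  then obtain S q where S: "pairwise orthogonal S" "0 \<notin> S" "span S = E r"
    and q: "\<And>s. s \<in> S \<Longrightarrow> q s < r" "\<And>s. s \<in> S \<Longrightarrow> s \<in> E (Suc (q s))"
      "\<And>s u. s \<in> S \<Longrightarrow> u \<in> E (q s) \<Longrightarrow> s \<bullet> u = 0"
    and card: "\<And>k. k \<le> r \<Longrightarrow> card {s\<in>S. q s < k} = dim (E k)" by blast
  obtain U where U: "U \<inter> insert 0 S = {}" "pairwise orthogonal (S \<union> U)"
      "span (S \<union> U) = span (S \<union> E (Suc r))"
    using orthogonal_extension_strong[OF S(1), of "E (Suc r)"] by blast
  have "S \<subseteq> E (Suc r)" using S(3) span_superset mono[of r "Suc r"] by fastforce
  then have span: "span (S \<union> U) = E (Suc r)"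
    using U(3) sub[of "Suc r"] by (simp add: Un_absorb1 span_eq_iff)
  \<comment> \<open>Vectors added at this stage get level \<open>r\<close>: they lie in
    \<open>E (Suc r)\<close> and are orthogonal to \<open>E r\<close>.\<close>
  define q' where "q' = (\<lambda>s. if s \<in> S then q s else r)"
  have q'U: "q' s = r" if "s \<in> U" for s using that U(1) by (auto simp: q'_def)
  have orth: "s \<bullet> u = 0" if "s \<in> U" "u \<in> E r" for s u
  proof -
    have "orthogonal s u"
    proof (rule orthogonal_to_span[of u S])
      show "u \<in> span S" using that S(3) by simp
      show "orthogonal s y" if "y \<in> S" for y
        using U(1) pairwiseD[OF U(2), of s y] that \<open>s \<in> U\<close> by blast
    qed
    then show ?thesis by (simp add: orthogonal_def)
  qed
  have "card {s\<in>S \<union> U. q' s < k} = dim (E k)" if "k \<le> Suc r" for k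
  proof (cases "k = Suc r")
    case True
    have "{s\<in>S \<union> U. q' s < k} = S \<union> U" using q(1) q'U True by (auto simp: q'_def less_SucI)
    moreover have "0 \<notin> S \<union> U" using U(1) S(2) by auto
    then have "card (S \<union> U) = dim (E (Suc r))"
      using pairwise_orthogonal_independent[OF U(2)] dim_eq_card_independent[of "S \<union> U"] span
        dim_span[of "S \<union> U"] by simp
    ultimately show ?thesis using True by simp
  next
    case False
    then have "{s\<in>S \<union> U. q' s < k} = {s\<in>S. q s < k}"
      using that q'U by (auto simp: q'_def)
    then show ?thesis using card[of k] that False by simp
  qed
  moreover have "q' s < Suc r \<and> s \<in> E (Suc (q' s)) \<and> (\<forall>u\<in>E (q' s). s \<bullet> u = 0)" if "s \<in> S \<union> U" for s
  proof (cases "s \<in> S")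
    case True
    then show ?thesis using q[OF True] by (auto simp: q'_def)
  next
    case False
    then have "s \<in> U" using that by simp
    then show ?thesis using q'U orth span span_superset by (metis UnCI lessI subsetD)
  qed
  ultimately show ?case
    using U S(2) span by (intro exI[of _ "S \<union> U"] exI[of _ q']) auto
qed

text \<open>An orthogonal set spanning the full space has \<open>CARD('n)\<close> elements, so it
  can be indexed by \<open>'n\<close>. The span claim is a dimension count: the vectors of level
  below \<open>r\<close> are independent, lie in \<open>E r\<close>, and number
  \<open>dim (E r)\<close>.\<close>

lemma adapted_basis:
  fixes E :: "nat \<Rightarrow> (real^'n) set"
  assumes sub: "\<And>r. subspace (E r)" and mono: "\<And>r s. r \<le> s \<Longrightarrow> E r \<subseteq> E s"
    and E0: "E 0 = {0}" and Em: "dim (E m) = CARD('n)"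
  obtains e :: "'n \<Rightarrow> real^'n" and p :: "'n \<Rightarrow> nat"
  where "\<And>j. p j < m" "\<And>j. e j \<in> E (Suc (p j))"
    "\<And>j u. u \<in> E (p j) \<Longrightarrow> e j \<bullet> u = 0" "\<And>r. r \<le> m \<Longrightarrow> card {j. p j < r} = dim (E r)"
    "\<And>r. r \<le> m \<Longrightarrow> span (e ` {j. p j < r}) = E r"
proof -
  obtain S q where S: "pairwise orthogonal S" "0 \<notin> S" "span S = E m"
    and q: "\<And>s. s \<in> S \<Longrightarrow> q s < m" "\<And>s. s \<in> S \<Longrightarrow> s \<in> E (Suc (q s))"
      "\<And>s u. s \<in> S \<Longrightarrow> u \<in> E (q s) \<Longrightarrow> s \<bullet> u = 0"
    and card: "\<And>k. k \<le> m \<Longrightarrow> card {s\<in>S. q s < k} = dim (E k)"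
    using adapted_orthogonal_set[of E m, OF sub mono E0] by blast
  have indep: "independent S" by (rule pairwise_orthogonal_independent[OF S(1,2)])
  have "finite S" using indep by (rule independent_imp_finite)
  moreover have "card S = CARD('n)"
    using dim_eq_card_independent[OF indep] dim_span[of S] S(3) Em by simp
  ultimately obtain e :: "'n \<Rightarrow> real^'n" where e: "bij_betw e UNIV S"
    using finite_same_card_bij[of "UNIV :: 'n set" S] by auto
  have eS: "e j \<in> S" for j using e by (auto simp: bij_betw_def)
  have img: "e ` {j. q (e j) < r} = {s\<in>S. q s < r}" for r
    using e by (auto simp: bij_betw_def)
  have inj: "inj e" using e by (simp add: bij_betw_def)
  have card': "card {j. q (e j) < r} = dim (E r)" if "r \<le> m" for r
    using card[OF that] card_image[OF inj_on_subset[OF inj], of "{j. q (e j) < r}"] img by simp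
  show thesis
  proof (rule that[of "\<lambda>j. q (e j)" e])
    show "span (e ` {j. q (e j) < r}) = E r" if "r \<le> m" for r
    proof -
      have "{s\<in>S. q s < r} \<subseteq> E r"
      proof clarify
        fix s assume "s \<in> S" "q s < r"
        then show "s \<in> E r" using q(2)[of s] mono[of "Suc (q s)" r] by auto
      qed
      moreover have "independent {s\<in>S. q s < r}"
        using indep by (rule independent_mono) auto
      ultimately have "E r \<subseteq> span {s\<in>S. q s < r}"
        by (intro card_ge_dim_independent) (simp_all add: card[OF that])
      with \<open>{s\<in>S. q s < r} \<subseteq> E r\<close> show ?thesis
        unfolding img by (intro equalityI span_minimal sub)
    qed
  qed (use q eS card' in auto)
qed

text \<open>The difference \<open>d i - d (i - 1)\<close> counts the indices with
  \<open>Suc (p j) = i\<close>, and each of them contributes \<open>2 * i - 1 = 2 * p j + 1\<close>.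
  With \<open>d\<close> the dimensions of the flag, the left side is \<open>Nexp\<close>.\<close>

lemma sum_levels:
  fixes p :: "'n::finite \<Rightarrow> nat" and d :: "nat \<Rightarrow> nat"
  assumes p: "\<And>j. p j < m" and d: "\<And>r. r \<le> m \<Longrightarrow> card {j. p j < r} = d r"
  shows "(\<Sum>i=1..m. (2 * i - 1) * (d i - d (i - 1))) = (\<Sum>j\<in>UNIV. 2 * p j + 1)"
proof -
  have "(\<Sum>j\<in>UNIV. 2 * p j + 1) = (\<Sum>i\<in>{1..m}. \<Sum>j | j \<in> UNIV \<and> Suc (p j) = i. 2 * p j + 1)"
    using p by (intro sum.group[symmetric]) (auto simp: Suc_le_eq)
  also have "\<dots> = (\<Sum>i=1..m. (2 * i - 1) * (d i - d (i - 1)))"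
  proof (rule sum.cong[OF refl])
    fix i assume i: "i \<in> {1..m}"
    have "{j. p j < i} = {j. p j < i - 1} \<union> {j. Suc (p j) = i}" using i by auto
    then have "card {j. p j < i} = card {j. p j < i - 1} + card {j. Suc (p j) = i}"
      by (simp only:) (intro card_Un_disjoint, auto)
    then have "card {j. Suc (p j) = i} = d i - d (i - 1)" using d[of i] d[of "i - 1"] i by auto
    moreover have "(\<Sum>j | j \<in> UNIV \<and> Suc (p j) = i. 2 * p j + 1) = (\<Sum>j | Suc (p j) = i. 2 * i - 1)"
      by (intro sum.cong) auto
    ultimately show "(\<Sum>j | j \<in> UNIV \<and> Suc (p j) = i. 2 * p j + 1) = (2 * i - 1) * (d i - d (i - 1))"
      by (simp add: mult.commute)
  qed
  finally show ?thesis by simp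
qed

section \<open>First-order expansions at 0\<close>

text \<open>The relation \<open>f t = a + O(t)\<close> from the right at 0. It is stable under sums,
  products and inverses, so limits and error terms are propagated together.\<close>

definition first_order :: "(real \<Rightarrow> real) \<Rightarrow> real \<Rightarrow> bool" where
  "first_order f a \<longleftrightarrow> (\<lambda>t. f t - a) \<in> O[at_right 0](\<lambda>t. t)"

lemma first_order_tendsto:
  assumes "first_order f a"
  shows "(f \<longlongrightarrow> a) (at_right 0)"
proof -
  have "((\<lambda>t::real. t) \<longlongrightarrow> 0) (at_right 0)" by (rule tendsto_ident_at)
  then have "(\<lambda>t::real. t) \<in> o[at_right 0](\<lambda>_. 1)" by (intro smalloI_tendsto) auto
  then have "(\<lambda>t. f t - a) \<in> o[at_right 0](\<lambda>_. 1)"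
    using assms unfolding first_order_def by (rule landau_o.big_small_trans[rotated])
  then have "((\<lambda>t. f t - a) \<longlongrightarrow> 0) (at_right 0)"
    using smalloD_tendsto by fastforce
  then show ?thesis by (simp add: LIM_zero_iff)
qed

lemma first_order_bounded: "first_order f a \<Longrightarrow> f \<in> O[at_right 0](\<lambda>_. 1)"
  by (rule bigoI_tendsto[where c = a]) (auto dest: first_order_tendsto)

lemma first_order_cong:
  assumes "\<forall>\<^sub>F t in at_right 0. f t = g t"
  shows "first_order f a \<longleftrightarrow> first_order g a"
  unfolding first_order_def
  by (intro landau_o.big.in_cong) (use assms in eventually_elim, simp)

lemma first_order_const: "first_order (\<lambda>_. a) a"
  by (simp add: first_order_def)

lemma first_order_add:
  assumes "first_order f a" "first_order g b"
  shows "first_order (\<lambda>t. f t + g t) (a + b)"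
proof -
  have "(\<lambda>t. (f t - a) + (g t - b)) \<in> O[at_right 0](\<lambda>t. t)"
    using assms unfolding first_order_def by (rule sum_in_bigo)
  then show ?thesis by (simp add: first_order_def algebra_simps)
qed

lemma first_order_mult:
  assumes "first_order f a" "first_order g b"
  shows "first_order (\<lambda>t. f t * g t) (a * b)"
proof -
  have "(\<lambda>t. (f t - a) * g t) \<in> O[at_right 0](\<lambda>t. t * 1)"
    using assms(1) first_order_bounded[OF assms(2)] unfolding first_order_def
    by (rule landau_o.big.mult)
  moreover have "(\<lambda>t. a * (g t - b)) \<in> O[at_right 0](\<lambda>t. t)"
    using assms(2) unfolding first_order_def by simp
  ultimately have "(\<lambda>t. (f t - a) * g t + a * (g t - b)) \<in> O[at_right 0](\<lambda>t. t)"
    by (intro sum_in_bigo) simp_all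
  then show ?thesis by (simp add: first_order_def algebra_simps)
qed

lemma first_order_sum:
  assumes "\<And>j. j \<in> J \<Longrightarrow> first_order (f j) (a j)"
  shows "first_order (\<lambda>t. \<Sum>j\<in>J. f j t) (\<Sum>j\<in>J. a j)"
  using assms by (induction J rule: infinite_finite_induct)
    (auto intro: first_order_add first_order_const)

lemma first_order_prod:
  assumes "\<And>j. j \<in> J \<Longrightarrow> first_order (f j) (a j)"
  shows "first_order (\<lambda>t. \<Prod>j\<in>J. f j t) (\<Prod>j\<in>J. a j)"
  using assms by (induction J rule: infinite_finite_induct)
    (auto intro: first_order_mult first_order_const)

text \<open>The difference of the inverses is \<open>f t - a\<close> times
  \<open>- inverse (f t) * inverse a\<close>, which is bounded near 0 because \<open>f\<close> has a
  nonzero limit.\<close>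

lemma first_order_inverse:
  assumes "first_order f a" "a \<noteq> 0"
  shows "first_order (\<lambda>t. inverse (f t)) (inverse a)"
proof -
  have lim: "(f \<longlongrightarrow> a) (at_right 0)" by (rule first_order_tendsto[OF assms(1)])
  have "((\<lambda>t. - inverse (f t) * inverse a) \<longlongrightarrow> - inverse a * inverse a) (at_right 0)"
    using lim assms(2) by (intro tendsto_intros)
  then have "(\<lambda>t. - inverse (f t) * inverse a) \<in> O[at_right 0](\<lambda>_. 1)"
    by (intro bigoI_tendsto) auto
  with assms(1) have "(\<lambda>t. (f t - a) * (- inverse (f t) * inverse a)) \<in> O[at_right 0](\<lambda>t. t * 1)"
    unfolding first_order_def by (rule landau_o.big.mult)
  moreover have "\<forall>\<^sub>F t in at_right 0. (f t - a) * (- inverse (f t) * inverse a) = inverse (f t) - inverse a"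
    using tendsto_imp_eventually_ne[OF lim assms(2)]
    by eventually_elim (use assms(2) in \<open>simp add: field_simps\<close>)
  ultimately show ?thesis
    unfolding first_order_def mult_1_right by (rule landau_o.big.in_cong[THEN iffD1, rotated])
qed

lemma first_order_det:
  fixes G :: "real \<Rightarrow> real^'n^'n"
  assumes "\<And>j l. first_order (\<lambda>t. G t $ j $ l) (G0 $ j $ l)"
  shows "first_order (\<lambda>t. det (G t)) (det G0)"
  unfolding det_def
  by (intro first_order_sum first_order_mult first_order_const first_order_prod assms)

text \<open>Cramer's rule writes the form as a rational expression in the entries of
  \<open>G t\<close> and \<open>z t\<close>, to which the closure rules apply. The matrix
  \<open>c G z k\<close> is \<open>G\<close> with column \<open>k\<close> replaced by
  \<open>z\<close>.\<close>

lemma first_order_inverse_quadratic_form: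
  fixes G :: "real \<Rightarrow> real^'n^'n" and z :: "real \<Rightarrow> real^'n"
  assumes G: "\<And>j l. first_order (\<lambda>t. G t $ j $ l) (G0 $ j $ l)"
    and z: "\<And>j. first_order (\<lambda>t. z t $ j) (z0 $ j)" and G0: "det G0 \<noteq> 0"
  shows "first_order (\<lambda>t. z t \<bullet> (matrix_inv (G t) *v z t)) (z0 \<bullet> (matrix_inv G0 *v z0))"
proof -
  define c :: "real^'n^'n \<Rightarrow> real^'n \<Rightarrow> 'n \<Rightarrow> real^'n^'n"
    where "c = (\<lambda>G z k. \<chi> i j. if j = k then z $ i else G $ i $ j)"
  have form: "z \<bullet> (matrix_inv G *v z) = (\<Sum>k\<in>UNIV. z $ k * (det (c G z k) * inverse (det G)))"
    if "det G \<noteq> 0" for z and G :: "real^'n^'n"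
  proof -
    have "matrix_inv G *v z = (\<chi> k. det (c G z k) / det G)"
      using that cramer[OF that, of "(\<chi> k. det (c G z k) / det G)" z]
      by (intro matrix_inv_vector_eq) (auto simp: invertible_det_nz c_def)
    then show ?thesis by (simp add: inner_vec_def divide_inverse)
  qed
  have det: "first_order (\<lambda>t. det (G t)) (det G0)" by (rule first_order_det[OF G])
  have "first_order (\<lambda>t. \<Sum>k\<in>UNIV. z t $ k * (det (c (G t) (z t) k) * inverse (det (G t))))
     (\<Sum>k\<in>UNIV. z0 $ k * (det (c G0 z0 k) * inverse (det G0)))"
    by (intro first_order_sum first_order_mult first_order_inverse first_order_det z det G0)
       (auto simp: c_def intro: G z)
  moreover have "\<forall>\<^sub>F t in at_right 0. z t \<bullet> (matrix_inv (G t) *v z t) =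
      (\<Sum>k\<in>UNIV. z t $ k * (det (c (G t) (z t) k) * inverse (det (G t))))"
    using tendsto_imp_eventually_ne[OF first_order_tendsto[OF det] G0]
    by eventually_elim (rule form)
  ultimately show ?thesis
    unfolding form[OF G0] by (simp add: first_order_cong)
qed

section \<open>Leading terms of power series and of integrals\<close>

lemma eventually_pos_at_right: "\<forall>\<^sub>F t::real in at_right 0. 0 < t"
  by (rule eventually_at_right_less)

lemma first_order_divide_power_iff:
  "first_order (\<lambda>t. f t / t ^ p) a \<longleftrightarrow> (\<lambda>t. f t - a * t ^ p) \<in> O[at_right 0](\<lambda>t. t ^ Suc p)"
proof -
  have nz: "\<forall>\<^sub>F t::real in at_right 0. t ^ p \<noteq> 0"
    using eventually_pos_at_right by eventually_elim simp
  have "(\<lambda>t. f t - a * t ^ p) \<in> O[at_right 0](\<lambda>t. t ^ Suc p) \<longleftrightarrow>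
      (\<lambda>t. t ^ p * (f t / t ^ p - a)) \<in> O[at_right 0](\<lambda>t. t ^ Suc p)"
    by (intro landau_o.big.in_cong) (use nz in eventually_elim, simp add: field_simps)
  also have "\<dots> \<longleftrightarrow> (\<lambda>t. t ^ p * (f t / t ^ p - a)) \<in> O[at_right 0](\<lambda>t. t ^ p * t)"
    by (simp add: mult.commute)
  also have "\<dots> \<longleftrightarrow> (\<lambda>t. f t / t ^ p - a) \<in> O[at_right 0](\<lambda>t. t)"
    by (rule landau_o.big.mult_cancel_left) (use nz in auto)
  finally show ?thesis by (simp add: first_order_def)
qed

text \<open>For \<open>0 < t < 1\<close> the terms of index above \<open>p\<close> are dominated by
  \<open>\<bar>c k\<bar> * t ^ Suc p\<close>, so absolute summability of the coefficients supplies
  the constant of the error term.\<close>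

lemma powser_leading_term:
  fixes c :: "nat \<Rightarrow> real" and f :: "real \<Rightarrow> real"
  assumes sums: "\<And>t. (\<lambda>k. c k * t ^ k) sums f t"
    and abs: "summable (\<lambda>k. \<bar>c k\<bar>)"
    and zero: "\<And>k. k < p \<Longrightarrow> c k = 0"
  shows "first_order (\<lambda>t. f t / t ^ p) (c p)"
  unfolding first_order_divide_power_iff
proof (rule bigoI)
  have "eventually (\<lambda>t::real. 0 < t \<and> t < 1) (at_right 0)"
    by (auto simp: eventually_at_right[of 0 1] intro!: exI[of _ 1])
  then show "\<forall>\<^sub>F t in at_right 0. norm (f t - c p * t ^ p) \<le> (\<Sum>k. \<bar>c (k + Suc p)\<bar>) * norm (t ^ Suc p)"
  proof eventually_elim
    case (elim t)
    have "(\<lambda>k. c (k + Suc p) * t ^ (k + Suc p)) sums (f t - (\<Sum>k<Suc p. c k * t ^ k))"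
      using sums_split_initial_segment[OF sums] by blast
    moreover have "(\<Sum>k<Suc p. c k * t ^ k) = c p * t ^ p"
      using zero by simp
    ultimately have s: "(\<lambda>k. c (k + Suc p) * t ^ (k + Suc p)) sums (f t - c p * t ^ p)" by simp
    have sm: "summable (\<lambda>k. \<bar>c (k + Suc p)\<bar> * t ^ Suc p)"
      using abs summable_iff_shift[of "\<lambda>k. \<bar>c k\<bar>" "Suc p"] by (intro summable_mult2) simp
    have "norm (c (k + Suc p) * t ^ (k + Suc p)) \<le> \<bar>c (k + Suc p)\<bar> * t ^ Suc p" for k
      using elim by (simp add: abs_mult power_add mult_left_le_one_le mult_left_mono power_le_one)
    then have "norm (\<Sum>k. c (k + Suc p) * t ^ (k + Suc p)) \<le> (\<Sum>k. \<bar>c (k + Suc p)\<bar> * t ^ Suc p)"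
      by (rule norm_suminf_le[OF _ sm])
    also have "\<dots> = (\<Sum>k. \<bar>c (k + Suc p)\<bar>) * t ^ Suc p"
      using abs summable_iff_shift[of "\<lambda>k. \<bar>c k\<bar>" "Suc p"] by (intro suminf_mult2[symmetric]) simp
    finally show ?case using sums_unique[OF s] elim by (simp add: abs_mult)
  qed
qed

lemma first_order_power: "first_order (\<lambda>t. t ^ k) (0 ^ k)"
proof (induction k)
  case (Suc k)
  have "first_order (\<lambda>t. t) 0" by (simp add: first_order_def)
  from first_order_mult[OF this Suc] show ?case by simp
qed (simp add: first_order_const)

text \<open>The monomial integrates exactly. The remainder is at most \<open>c * t ^ Suc p\<close>
  throughout the interval, and the length \<open>t\<close> of the interval gives the additional
  power.\<close>

lemma first_order_integral:
  fixes f :: "real \<Rightarrow> real"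
  assumes cont: "\<And>t. isCont f t"
    and f: "first_order (\<lambda>t. f t / t ^ p) a"
  shows "first_order (\<lambda>t. integral {0..t} f / t ^ Suc p) (a / real (Suc p))"
proof -
  have "(\<lambda>t. f t - a * t ^ p) \<in> O[at_right 0](\<lambda>t. t ^ Suc p)"
    using f unfolding first_order_divide_power_iff .
  then obtain c where "c > 0" and "\<forall>\<^sub>F t in at_right 0. norm (f t - a * t ^ p) \<le> c * norm (t ^ Suc p)"
    by (elim landau_o.bigE)
  then obtain b where "b > 0" and b: "\<And>t. 0 < t \<Longrightarrow> t < b \<Longrightarrow> \<bar>f t - a * t ^ p\<bar> \<le> c * \<bar>t ^ Suc p\<bar>"
    by (auto simp: eventually_at_right[of 0 1] simp del: power_Suc)
  have "\<forall>\<^sub>F t in at_right 0. 0 < t \<and> t < b"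
    using \<open>b > 0\<close> by (auto simp: eventually_at_right[of 0 b])
  then have "\<forall>\<^sub>F t in at_right 0. norm (integral {0..t} f - a / real (Suc p) * t ^ Suc p) \<le> c * norm (t ^ Suc (Suc p))"
  proof eventually_elim
    case (elim t)
    have "((\<lambda>s. a * s ^ p) has_integral (a * t ^ Suc p / real (Suc p) - a * 0 ^ Suc p / real (Suc p))) {0..t}"
    proof (rule fundamental_theorem_of_calculus)
      fix s :: real
      have "((\<lambda>s. a * s ^ Suc p / real (Suc p)) has_real_derivative a * (real (Suc p) * s ^ p) / real (Suc p)) (at s within {0..t})"
        by (intro derivative_eq_intros refl) auto
      then show "((\<lambda>s. a * s ^ Suc p / real (Suc p)) has_vector_derivative a * s ^ p) (at s within {0..t})"
        by (simp add: has_real_derivative_iff_has_vector_derivative del: of_nat_Suc power_Suc)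
    qed (use elim in simp)
    moreover have "(f has_integral integral {0..t} f) {0..t}"
      by (intro integrable_integral integrable_continuous_real continuous_at_imp_continuous_on ballI cont)
    ultimately have "((\<lambda>s. f s - a * s ^ p) has_integral (integral {0..t} f -
        (a * t ^ Suc p / real (Suc p) - a * 0 ^ Suc p / real (Suc p)))) {0..t}"
      by (rule has_integral_diff[rotated])
    then have int: "((\<lambda>s. f s - a * s ^ p) has_integral (integral {0..t} f - a / real (Suc p) * t ^ Suc p)) (cbox 0 t)"
      by simp
    have "norm (integral {0..t} f - a / real (Suc p) * t ^ Suc p) \<le> (c * t ^ Suc p) * measure lborel (cbox 0 t)"
    \<comment> \<open>The bound on the integrand is available only for positive arguments, so the
      endpoint 0 is removed as a negligible set.\<close>
    proof (rule has_integral_bound_spike_finite[OF _ _ int, where S = "{0}"])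
      fix s assume "s \<in> cbox 0 t - {0}"
      then have s: "0 < s" "s \<le> t" by auto
      then have "norm (f s - a * s ^ p) \<le> c * s ^ Suc p" using b[of s] elim by simp
      also have "\<dots> \<le> c * t ^ Suc p"
        using s \<open>c > 0\<close> by (intro mult_left_mono power_mono) auto
      finally show "norm (f s - a * s ^ p) \<le> c * t ^ Suc p" .
    qed (use elim \<open>c > 0\<close> in auto)
    then show ?case using elim by (simp add: mult_ac)
  qed
  then show ?thesis unfolding first_order_divide_power_iff by (rule bigoI)
qed

section \<open>Rescaling in an adapted basis\<close>

lemma bounded_linear_matrix_form: "bounded_linear (\<lambda>X::real^'m^'n. u \<bullet> (X *v y))"
  unfolding linear_conv_bounded_linear[symmetric]
  by (rule linearI)
    (simp_all add: matrix_vector_mult_add_rdistrib inner_add_right flip: scaleR_matrix_vector_assoc)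

lemma mexp_form_coeff_summable: "summable (\<lambda>k. \<bar>(-1) ^ k / fact k * (u \<bullet> (mpow A k *v y))\<bar>)"
  using mexp_linear_image(2)[OF bounded_linear_matrix_form[of u y], of A 1] by (simp add: abs_mult)

lemma mexp_form_sums:
  "(\<lambda>k. ((-1) ^ k / fact k * (u \<bullet> (mpow A k *v y))) * t ^ k) sums (u \<bullet> (mexp (-t) A *v y))"
  using mexp_linear_image(1)[OF bounded_linear_matrix_form[of u y], of A "-t"]
  by (simp add: power_minus[of t] mult_ac)

lemma mexp_leading_term:
  assumes "\<And>k. k < q \<Longrightarrow> u \<bullet> (mpow A k *v y) = 0"
  shows "first_order (\<lambda>t. u \<bullet> (mexp (-t) A *v y) / t ^ q) ((-1) ^ q / fact q * (u \<bullet> (mpow A q *v y)))"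
  by (rule powser_leading_term[OF mexp_form_sums mexp_form_coeff_summable]) (simp add: assms)

text \<open>Subtracting \<open>y\<close> removes the constant coefficient of the series, so the
  vanishing condition starts at \<open>k = 1\<close>.\<close>

lemma mexp_diff_leading_term:
  assumes "\<And>k. 1 \<le> k \<Longrightarrow> k < q \<Longrightarrow> u \<bullet> (mpow A k *v y) = 0" and "1 \<le> q"
  shows "first_order (\<lambda>t. u \<bullet> (mexp (-t) A *v y - y) / t ^ q) ((-1) ^ q / fact q * (u \<bullet> (mpow A q *v y)))"
proof -
  define c where "c k = (if k = 0 then 0 else (-1) ^ k / fact k * (u \<bullet> (mpow A k *v y)))" for k
  have "(\<lambda>k. c k * t ^ k) sums (u \<bullet> (mexp (-t) A *v y - y))" for t
  proof -
    have "(\<lambda>k. ((-1) ^ k / fact k * (u \<bullet> (mpow A k *v y))) * t ^ k - (if k = 0 then u \<bullet> y else 0)) sums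
        (u \<bullet> (mexp (-t) A *v y) - u \<bullet> y)"
      using sums_single[of 0 "\<lambda>_. u \<bullet> y"] by (intro sums_diff mexp_form_sums) simp
    moreover have "((-1) ^ k / fact k * (u \<bullet> (mpow A k *v y))) * t ^ k - (if k = 0 then u \<bullet> y else 0) = c k * t ^ k" for k
      by (simp add: c_def)
    ultimately show ?thesis by (simp add: inner_diff_right)
  qed
  moreover have "summable (\<lambda>k. \<bar>c k\<bar>)"
    by (rule summable_comparison_test'[OF mexp_form_coeff_summable[of u A y], where N = 0])
       (simp add: c_def)
  ultimately have "first_order (\<lambda>t. u \<bullet> (mexp (-t) A *v y - y) / t ^ q) (c q)"
    by (rule powser_leading_term) (simp add: c_def assms(1))
  then show ?thesis using assms(2) by (simp add: c_def)
qed

section \<open>The Gramian as an integral of inner products\<close>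

lemma inner_mult_transpose:
  "e \<bullet> ((X ** B ** transpose B ** transpose X) *v e') = (transpose (X ** B) *v e) \<bullet> (transpose (X ** B) *v e')"
  for X :: "real^'n^'n" and B :: "real^'k^'n"
proof -
  have "(X ** B ** transpose B ** transpose X) *v e' = (X ** B) *v (transpose (X ** B) *v e')"
    by (simp add: matrix_vector_mul_assoc matrix_transpose_mul matrix_mul_assoc)
  then show ?thesis
    by (metis dot_lmul_matrix transpose_matrix_vector)
qed

lemma isCont_noise_form:
  "isCont (\<lambda>t. (transpose (mexp (-t) A ** B) *v u) \<bullet> (transpose (mexp (-t) A ** B) *v v)) t"
proof -
  have form: "(transpose (mexp (-t) A ** B) *v u) \<bullet> (transpose (mexp (-t) A ** B) *v v) =
      (\<Sum>c\<in>UNIV. (u \<bullet> (mexp (-t) A *v column c B)) * (v \<bullet> (mexp (-t) A *v column c B)))" for t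
    unfolding inner_vec_def[of "transpose _ *v _"] transpose_mult_nth column_matrix_mult
    by (simp add: inner_commute)
  have cont: "isCont (\<lambda>t. u \<bullet> (mexp (-t) A *v y)) t" for u y
    by (rule isCont_mexp_uminus[OF bounded_linear_matrix_form])
  then show ?thesis
    unfolding form by (intro continuous_sum continuous_mult cont)
qed

text \<open>The functional \<open>u \<bullet> (X *v v)\<close> is bounded linear in \<open>X\<close>
  and hence passes through the matrix integral, which leaves a scalar integral.\<close>

lemma Gam_form:
  assumes "0 \<le> t"
  shows "u \<bullet> (Gam A B t *v v) = integral {0..t}
    (\<lambda>s. (transpose (mexp (-s) A ** B) *v u) \<bullet> (transpose (mexp (-s) A ** B) *v v))"
proof -
  let ?M = "\<lambda>s. mexp (-s) A ** B ** transpose B ** mexp (-s) (transpose A)"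
  have cont: "isCont (\<lambda>s. mexp (-s) A $ i $ j) s" for s i j
    by (rule isCont_mexp_uminus[OF bounded_linear_entry])
  have "isCont (\<lambda>s. ?M s $ i $ j) s" for s i j
    unfolding mexp_transpose
    unfolding matrix_matrix_mult_def transpose_def vec_lambda_beta
    by (intro continuous_sum continuous_mult continuous_const cont)
  then have "isCont ?M s" for s
    unfolding continuous_def by (intro vec_tendstoI)
  then have "?M integrable_on {0..t}"
    by (intro integrable_continuous_real continuous_at_imp_continuous_on ballI)
  then have "integral {0..t} ((\<lambda>X. u \<bullet> (X *v v)) \<circ> ?M) = u \<bullet> (integral {0..t} ?M *v v)"
    by (rule integral_linear[OF _ bounded_linear_matrix_form])
  moreover have "Gam A B t = integral {0..t} ?M" using assms by (simp add: Gam_def)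
  ultimately show ?thesis
    by (simp add: mexp_transpose inner_mult_transpose o_def)
qed

text \<open>Levels are counted from 0: \<open>e j\<close> spans a direction of the space with index \<open>Suc (p j)\<close>
  that is new over the one with index \<open>p j\<close>.\<close>

locale adapted_frame =
  fixes A :: "real^'n^'n" and B :: "real^'k^'n" and e :: "'n \<Rightarrow> real^'n" and p :: "'n \<Rightarrow> nat"
  assumes e_mem: "e j \<in> Espace A B (Suc (p j))"
    and e_orth: "u \<in> Espace A B (p j) \<Longrightarrow> e j \<bullet> u = 0"
    and det_frame: "det (\<chi> j. e j) \<noteq> 0"
begin

text \<open>The Taylor coefficient of order \<open>p j\<close> of
  \<open>transpose (mexp (-t) A ** B) *v e j\<close>; all coefficients of lower order
  vanish.\<close>

definition noise_coeff :: "'n \<Rightarrow> real^'k" where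
  "noise_coeff j = ((-1) ^ p j / fact (p j)) *\<^sub>R (transpose (mpow A (p j) ** B) *v e j)"

text \<open>The denominators are those of the integrals of \<open>s ^ (p j + p l)\<close> over the
  unit interval, so this is a matrix of the form treated in
  \<open>moment_gram_matrix_pos\<close>.\<close>

definition limit_gramian :: "real^'n^'n" where
  "limit_gramian = (\<chi> j l. (noise_coeff j \<bullet> noise_coeff l) / real (p j + p l + 1))"

text \<open>Two of the powers of \<open>t\<close> come from the leading orders \<open>p j\<close>
  and \<open>p l\<close>; the extra one accounts for integrating over \<open>{0..t}\<close>.\<close>

definition scaled_gramian :: "real \<Rightarrow> real^'n^'n" where
  "scaled_gramian t = (\<chi> j l. (e j \<bullet> (Gam A B t *v e l)) / t ^ Suc (p j + p l))"

definition scaled_frame :: "real \<Rightarrow> real^'n^'n" where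
  "scaled_frame t = (\<chi> j. (1 / t ^ p j) *s e j)"

text \<open>The factor \<open>mexp (-t) A\<close> cancels the outer exponentials of
  \<open>Dmat\<close>.\<close>

definition rescaling :: "real \<Rightarrow> real^'n^'n" where
  "rescaling t = scaled_frame t ** mexp (-t) A"

text \<open>For \<open>k < p j\<close> the columns of \<open>mpow A k ** B\<close> lie in the space
  of index \<open>p j\<close>, to which \<open>e j\<close> is orthogonal.\<close>

lemma noise_leading_term:
  "first_order (\<lambda>t. (transpose (mexp (-t) A ** B) *v e j) $ c / t ^ p j) (noise_coeff j $ c)"
proof -
  have form: "(transpose (X ** B) *v e j) $ c = e j \<bullet> (X *v column c B)" for X :: "real^'n^'n"
    by (simp add: transpose_mult_nth column_matrix_mult inner_commute del: transpose_matrix_vector)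
  have "e j \<bullet> (mpow A k *v column c B) = 0" if "k < p j" for k
    using e_orth[OF column_in_Espace[OF that, of c A B]] by (simp add: column_matrix_mult)
  then show ?thesis
    unfolding noise_coeff_def vector_scaleR_component form real_scaleR_def by (rule mexp_leading_term)
qed

lemma first_order_scaled_gramian: "first_order (\<lambda>t. scaled_gramian t $ j $ l) (limit_gramian $ j $ l)"
proof -
  let ?f = "\<lambda>t j. transpose (mexp (-t) A ** B) *v e j"
  have "first_order (\<lambda>t. \<Sum>c\<in>UNIV. (?f t j $ c / t ^ p j) * (?f t l $ c / t ^ p l)) (\<Sum>c\<in>UNIV. noise_coeff j $ c * noise_coeff l $ c)"
    by (intro first_order_sum first_order_mult noise_leading_term)
  then have "first_order (\<lambda>t. (?f t j \<bullet> ?f t l) / t ^ (p j + p l)) (noise_coeff j \<bullet> noise_coeff l)"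
    by (simp add: inner_vec_def power_add sum_divide_distrib)
  from first_order_integral[OF isCont_noise_form this]
  have "first_order (\<lambda>t. integral {0..t} (\<lambda>t. ?f t j \<bullet> ?f t l) / t ^ Suc (p j + p l)) (limit_gramian $ j $ l)"
    by (simp add: limit_gramian_def add.commute)
  moreover have "\<forall>\<^sub>F t in at_right 0. scaled_gramian t $ j $ l = integral {0..t} (\<lambda>t. ?f t j \<bullet> ?f t l) / t ^ Suc (p j + p l)"
    using eventually_pos_at_right by eventually_elim (simp add: scaled_gramian_def Gam_form)
  ultimately show ?thesis by (rule first_order_cong[THEN iffD2, rotated])
qed

lemma frame_combination_eq_0:
  assumes "(\<Sum>j\<in>UNIV. x $ j *\<^sub>R e j) = 0"
  shows "x = (0 :: real^'n)"
proof -
  have "transpose (\<chi> j. e j) *v x = (\<Sum>j\<in>UNIV. x $ j *\<^sub>R e j)"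
    by (simp add: vec_eq_iff matrix_vector_mult_def transpose_def mult.commute)
  moreover have "invertible (transpose (\<chi> j. e j))"
    using det_frame by (simp add: invertible_det_nz)
  ultimately show ?thesis
    using assms by (metis matrix_left_invertible_ker invertible_left_inverse)
qed

text \<open>If the weighted noise coefficients cancel on each level, then the level sum
  \<open>b r\<close> is orthogonal both to the space of index \<open>r\<close> and to the columns of
  \<open>mpow A r ** B\<close>. Hence it is orthogonal to the space of index \<open>Suc r\<close>,
  which contains it, so it is 0. Independence of the frame then gives \<open>x = 0\<close>.\<close>

lemma limit_gramian_pos:
  assumes "x \<noteq> 0"
  shows "0 < x \<bullet> (limit_gramian *v x)"
  unfolding limit_gramian_def
proof (rule moment_gram_matrix_pos[OF _ assms])
  fix x :: "real^'n"
  assume zero: "\<And>r. (\<Sum>j | p j = r. x $ j *\<^sub>R noise_coeff j) = 0"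
  define b where "b r = (\<Sum>j | p j = r. x $ j *\<^sub>R e j)" for r
  have b: "b r = 0" for r
  proof -
    have "((-1) ^ r / fact r) *\<^sub>R (transpose (mpow A r ** B) *v b r) = (\<Sum>j | p j = r. x $ j *\<^sub>R noise_coeff j)"
      by (simp add: b_def noise_coeff_def linear_sum[OF matrix_vector_mul_linear] matrix_vector_mult_scaleR scaleR_sum_right mult_ac)
    then have "transpose (mpow A r ** B) *v b r = 0" using zero[of r] by simp
    moreover have "b r \<bullet> u = 0" if "u \<in> Espace A B r" for u
      using that e_orth by (auto simp: b_def inner_sum_left)
    moreover have "b r \<in> Espace A B (Suc r)"
      unfolding b_def using e_mem by (intro subspace_sum subspace_mul subspace_Espace) auto
    ultimately have "b r \<bullet> b r = 0" by (intro orthogonal_Espace_Suc[where x = "b r"])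
    then show ?thesis by simp
  qed
  have "(\<Sum>j\<in>UNIV. x $ j *\<^sub>R e j) = (\<Sum>r\<in>range p. \<Sum>j | j \<in> UNIV \<and> p j = r. x $ j *\<^sub>R e j)"
    by (intro sum.group[symmetric]) auto
  also have "\<dots> = 0" using b by (simp add: b_def)
  finally show "x = 0" by (rule frame_combination_eq_0)
qed

text \<open>The exponentials cancel in pairs. The factor \<open>t\<close> remains because the
  conjugation divides by \<open>t ^ (p j + p l)\<close>, one power less than
  \<open>scaled_gramian\<close> does.\<close>

lemma rescaling_conj_Dmat:
  assumes "0 < t"
  shows "rescaling t ** Dmat A B t ** transpose (rescaling t) = t *\<^sub>R scaled_gramian t"
proof -
  have "rescaling t ** Dmat A B t ** transpose (rescaling t) =
      scaled_frame t ** (mexp (-t) A ** mexp t A) ** Gam A B t ** transpose (mexp (-t) A ** mexp t A) ** transpose (scaled_frame t)"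
    by (simp add: rescaling_def Dmat_def mexp_transpose matrix_transpose_mul matrix_mul_assoc)
  then have "rescaling t ** Dmat A B t ** transpose (rescaling t) = scaled_frame t ** Gam A B t ** transpose (scaled_frame t)"
    by (simp add: mexp_minus)
  moreover have "(scaled_frame t ** Gam A B t ** transpose (scaled_frame t)) $ j $ l = (t *\<^sub>R scaled_gramian t) $ j $ l" for j l
  proof -
    have "(scaled_frame t ** Gam A B t ** transpose (scaled_frame t)) $ j $ l = scaled_frame t $ j \<bullet> (Gam A B t *v (scaled_frame t $ l))"
      unfolding matrix_mul_assoc[symmetric]
      by (simp add: matrix_matrix_mult_def matrix_vector_mult_def transpose_def inner_vec_def)
    also have "\<dots> = (e j \<bullet> (Gam A B t *v e l)) / (t ^ p j * t ^ p l)"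
      by (simp add: scaled_frame_def matrix_vector_mult_scaleR scalar_mult_eq_scaleR)
    also have "\<dots> = (t *\<^sub>R scaled_gramian t) $ j $ l" using assms by (simp add: scaled_gramian_def power_add)
    finally show ?thesis .
  qed
  ultimately show ?thesis by (simp add: vec_eq_iff)
qed

lemma det_rescaling: "det (rescaling t) = (\<Prod>j\<in>UNIV. 1 / t ^ p j) * det (\<chi> j. e j) * det (mexp (-t) A)"
  unfolding rescaling_def scaled_frame_def det_mul det_rows_mul ..

lemma det_mexp_nz: "det (mexp t A) \<noteq> 0"
  using arg_cong[OF mexp_minus[of t A], of det] by (auto simp: det_mul)

lemma invertible_rescaling: "0 < t \<Longrightarrow> invertible (rescaling t)"
  by (simp add: invertible_det_nz det_rescaling det_frame det_mexp_nz)

text \<open>Taking determinants in the conjugation identity, the two rescalings contribute twice the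
  sum of the \<open>p j\<close> to the exponent, and the scalar factor \<open>t\<close> contributes
  \<open>CARD('n)\<close>.\<close>

lemma det_Dmat:
  assumes "0 < t"
  shows "det (Dmat A B t) = t ^ (\<Sum>j\<in>UNIV. 2 * p j + 1) * (det (scaled_gramian t) / (det (\<chi> j. e j) * det (mexp (-t) A))\<^sup>2)"
proof -
  have "det (rescaling t) * det (Dmat A B t) * det (rescaling t) = det (t *\<^sub>R scaled_gramian t)"
    unfolding rescaling_conj_Dmat[OF assms, symmetric] by (simp add: det_mul det_transpose)
  also have "\<dots> = t ^ CARD('n) * det (scaled_gramian t)"
    using det_rows_mul[of "\<lambda>_. t" "\<lambda>i. scaled_gramian t $ i"] by (simp add: scaleR_vec_def vector_scalar_mult_def)
  finally have "det (rescaling t) * det (Dmat A B t) * det (rescaling t) = t ^ CARD('n) * det (scaled_gramian t)" .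
  moreover have "(\<Prod>j\<in>UNIV. 1 / t ^ p j) = 1 / t ^ (\<Sum>j\<in>UNIV. p j)"
    by (simp add: prod_dividef power_sum)
  moreover have "t ^ (\<Sum>j\<in>UNIV. 2 * p j + 1) = (t ^ (\<Sum>j\<in>UNIV. p j))\<^sup>2 * t ^ CARD('n)"
  proof -
    have "(\<Sum>j\<in>UNIV. 2 * p j + 1) = (\<Sum>j\<in>UNIV. p j) * 2 + CARD('n)"
      by (simp add: sum.distrib sum_distrib_left[symmetric] sum_Suc)
    then show ?thesis by (simp only: power_add power_mult)
  qed
  ultimately show ?thesis
    using assms det_frame det_mexp_nz[of "-t"] unfolding det_rescaling
    by (simp add: field_simps power2_eq_square)
qed

lemma tendsto_det_ratio:
  "((\<lambda>t. det (scaled_gramian t) / (det (\<chi> j. e j) * det (mexp (-t) A))\<^sup>2) \<longlongrightarrow> det limit_gramian / (det (\<chi> j. e j))\<^sup>2) (at_right 0)"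
proof -
  have lim: "((\<lambda>t. mexp (-t) A $ i $ j) \<longlongrightarrow> mexp (-0) A $ i $ j) (at_right 0)" for i j
    using isCont_mexp_uminus[OF bounded_linear_entry[of i j], of 0 A]
    unfolding isCont_def by (rule tendsto_within_subset) simp
  have "((\<lambda>t. det (mexp (-t) A)) \<longlongrightarrow> det (mexp (-0) A)) (at_right 0)"
    unfolding det_def by (intro tendsto_sum tendsto_mult tendsto_prod tendsto_const lim)
  moreover have "((\<lambda>t. det (scaled_gramian t)) \<longlongrightarrow> det limit_gramian) (at_right 0)"
    by (intro first_order_tendsto first_order_det first_order_scaled_gramian)
  ultimately have "((\<lambda>t. det (scaled_gramian t) / (det (\<chi> j. e j) * det (mexp (-t) A))\<^sup>2) \<longlongrightarrow>
      det limit_gramian / (det (\<chi> j. e j) * det (mexp (-0) A))\<^sup>2) (at_right 0)"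
    using det_frame by (intro tendsto_intros) (auto simp: mexp_0)
  then show ?thesis by (simp add: mexp_0)
qed

text \<open>The congruence leaves one factor \<open>1 / t\<close>. The power
  \<open>t ^ (i - 2)\<close> is inserted in both arguments to keep the rescaled vector bounded in
  the application, and \<open>2 * i - 3 = 2 * (i - 2) + 1\<close> restores the balance.\<close>

lemma Dmat_inverse_form:
  assumes t: "0 < t" and detG: "det (scaled_gramian t) \<noteq> 0" and i: "2 \<le> i"
  shows "v \<bullet> (matrix_inv (Dmat A B t) *v v) =
    ((t ^ (i - 2) *\<^sub>R (rescaling t *v v)) \<bullet> (matrix_inv (scaled_gramian t) *v (t ^ (i - 2) *\<^sub>R (rescaling t *v v)))) / t ^ (2 * i - 3)"
proof -
  have inv: "invertible (scaled_gramian t)" "invertible (Dmat A B t)"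
    using detG t det_frame det_mexp_nz by (auto simp: invertible_det_nz det_Dmat)
  let ?y = "rescaling t *v v"
  have "matrix_inv (t *\<^sub>R scaled_gramian t) *v ?y = (1 / t) *\<^sub>R (matrix_inv (scaled_gramian t) *v ?y)"
  proof (rule matrix_inv_vector_eq)
    show "invertible (t *\<^sub>R scaled_gramian t)" using t inv(1) by (intro scalar_invertible) auto
    show "(t *\<^sub>R scaled_gramian t) *v (1 / t) *\<^sub>R (matrix_inv (scaled_gramian t) *v ?y) = ?y"
      using t
      by (simp add: matrix_vector_mult_scaleR matrix_inv_mult_vector inv(1) flip: scaleR_matrix_vector_assoc)
  qed
  then have "v \<bullet> (matrix_inv (Dmat A B t) *v v) = (?y \<bullet> (matrix_inv (scaled_gramian t) *v ?y)) / t"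
    using inverse_quadratic_form_congruence[OF inv(2) invertible_rescaling[OF t], of v] rescaling_conj_Dmat[OF t] by simp
  moreover have "t ^ (2 * i - 3) = t ^ (i - 2) * t ^ (i - 2) * t"
  proof -
    have "2 * i - 3 = Suc ((i - 2) + (i - 2))" using i by simp
    then show ?thesis by (simp only: power_Suc power_add mult.commute)
  qed
  ultimately show ?thesis using t by (simp add: matrix_vector_mult_scaleR)
qed

text \<open>Component \<open>j\<close> is \<open>t ^ (i - 2) / t ^ p j\<close> times
  \<open>e j \<bullet> ?w t\<close>. On levels \<open>p j \<ge> i - 1\<close> the flag makes the low
  Taylor coefficients of \<open>?w\<close> orthogonal to \<open>e j\<close>, just enough to
  compensate the division; on lower levels the estimate \<open>?w t = O(t)\<close> suffices and the
  limit is 0.\<close>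

lemma drift_leading_term:
  assumes i: "2 \<le> i" and x0: "A *v x0 \<in> Espace A B i"
  obtains z :: "real^'n" where
    "\<And>j. first_order (\<lambda>t. (t ^ (i - 2) *\<^sub>R (rescaling t *v (x0 - mexp t A *v x0))) $ j) (z $ j)"
    "\<And>j. p j = i - 1 \<Longrightarrow> z $ j = - (e j \<bullet> (A *v x0))"
proof -
  let ?w = "\<lambda>t. mexp (-t) A *v x0 - x0"
  have comp: "(t ^ (i - 2) *\<^sub>R (rescaling t *v (x0 - mexp t A *v x0))) $ j = t ^ (i - 2) * ((e j \<bullet> ?w t) / t ^ p j)" for t j
  proof -
    have "rescaling t *v (x0 - mexp t A *v x0) = scaled_frame t *v ?w t"
      by (simp add: rescaling_def mexp_minus matrix_vector_mult_diff_distrib matrix_vector_mul_assoc flip: matrix_mul_assoc)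
    then show ?thesis
      by (simp add: scaled_frame_def matrix_vector_mult_def inner_vec_def sum_divide_distrib)
  qed
  have "\<exists>z. first_order (\<lambda>t. t ^ (i - 2) * ((e j \<bullet> ?w t) / t ^ p j)) z \<and>
      (p j = i - 1 \<longrightarrow> z = - (e j \<bullet> (A *v x0)))" for j
  proof (cases "i \<le> Suc (p j)")
    case True
    \<comment> \<open>The order left after the powers of \<open>t\<close> cancel. For
      \<open>1 \<le> k < q\<close> the vector \<open>mpow A k *v x0\<close> lies in the space of
      index \<open>i + k - 1 \<le> p j\<close>; on level \<open>i - 1\<close> one has
      \<open>q = 1\<close>, so the limit involves \<open>A *v x0\<close> itself.\<close>
    define q where "q = p j + 2 - i"
    have pq: "p j = (i - 2) + q" "1 \<le> q" using True i by (auto simp: q_def)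
    have "e j \<bullet> (mpow A k *v x0) = 0" if k: "1 \<le> k" "k < q" for k
    proof -
      obtain k' where k': "k = Suc k'" using k by (cases k) auto
      have "mpow A k *v x0 = mpow A k' *v (A *v x0)"
        by (simp add: k' mpow_commute matrix_vector_mul_assoc)
      also have "\<dots> \<in> Espace A B (i + k')" by (rule Espace_mpow_mult[OF x0])
      also have "\<dots> \<subseteq> Espace A B (p j)" using k k' pq i by (intro Espace_mono) auto
      finally show ?thesis by (rule e_orth)
    qed
    then have "first_order (\<lambda>t. e j \<bullet> ?w t / t ^ q) ((-1) ^ q / fact q * (e j \<bullet> (mpow A q *v x0)))"
      using pq(2) by (rule mexp_diff_leading_term)
    moreover have "\<forall>\<^sub>F t in at_right 0. t ^ (i - 2) * ((e j \<bullet> ?w t) / t ^ p j) = e j \<bullet> ?w t / t ^ q"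
      using eventually_pos_at_right by eventually_elim (simp add: pq(1) power_add)
    ultimately have "first_order (\<lambda>t. t ^ (i - 2) * ((e j \<bullet> ?w t) / t ^ p j))
        ((-1) ^ q / fact q * (e j \<bullet> (mpow A q *v x0)))"
      by (simp add: first_order_cong)
    moreover have "(-1) ^ q / fact q * (e j \<bullet> (mpow A q *v x0)) = - (e j \<bullet> (A *v x0))" if "p j = i - 1"
    proof -
      have "q = 1" using that i by (simp add: q_def)
      then show ?thesis by simp
    qed
    ultimately show ?thesis by blast
  next
    case False
    define q where "q = i - 2 - p j"
    have pq: "i - 2 = p j + q" using False i by (auto simp: q_def)
    have "first_order (\<lambda>t. t ^ Suc q * (e j \<bullet> ?w t / t ^ 1)) (0 ^ Suc q * ((-1) ^ 1 / fact 1 * (e j \<bullet> (mpow A 1 *v x0))))"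
      by (intro first_order_mult first_order_power mexp_diff_leading_term) auto
    moreover have "\<forall>\<^sub>F t in at_right 0. t ^ (i - 2) * ((e j \<bullet> ?w t) / t ^ p j) = t ^ Suc q * (e j \<bullet> ?w t / t ^ 1)"
      using eventually_pos_at_right by eventually_elim (simp add: pq power_add)
    ultimately have "first_order (\<lambda>t. t ^ (i - 2) * ((e j \<bullet> ?w t) / t ^ p j)) 0"
      by (simp add: first_order_cong)
    then show ?thesis using False by (intro exI[of _ 0]) auto
  qed
  then have "\<exists>z. \<forall>j. first_order (\<lambda>t. t ^ (i - 2) * ((e j \<bullet> ?w t) / t ^ p j)) (z j) \<and>
      (p j = i - 1 \<longrightarrow> z j = - (e j \<bullet> (A *v x0)))"
    by (intro choice allI)
  then obtain z where "\<And>j. first_order (\<lambda>t. t ^ (i - 2) * ((e j \<bullet> ?w t) / t ^ p j)) (z j)"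
    "\<And>j. p j = i - 1 \<Longrightarrow> z j = - (e j \<bullet> (A *v x0))" by blast
  then show thesis by (intro that[of "\<chi> j. z j"]) (simp_all only: comp vec_lambda_beta)
qed

text \<open>Split \<open>b = y + w\<close> with \<open>y\<close> in the smaller space and
  \<open>w\<close> orthogonal to it. The vectors \<open>e j\<close> of top level annihilate
  \<open>b\<close> and \<open>y\<close>, hence \<open>w\<close>; those of lower level lie in the
  smaller space. So \<open>w\<close> is orthogonal to a spanning set of a space containing it, and
  \<open>w = 0\<close>.\<close>

lemma mem_Espace_pred:
  assumes i: "1 \<le> i" and span: "span (e ` {j. p j < i}) = Espace A B i"
    and b: "b \<in> Espace A B i" and zero: "\<And>j. p j = i - 1 \<Longrightarrow> e j \<bullet> b = 0"
  shows "b \<in> Espace A B (i - 1)"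
proof -
  have span': "span (Espace A B r) = Espace A B r" for r
    using subspace_Espace by (simp add: span_eq_iff)
  obtain y w where y: "y \<in> Espace A B (i - 1)" and w: "\<And>u. u \<in> Espace A B (i - 1) \<Longrightarrow> orthogonal w u"
    and byw: "b = y + w"
    using orthogonal_subspace_decomp_exists[of "Espace A B (i - 1)" b] unfolding span' by metis
  have "y \<in> Espace A B i" using y Espace_mono[of "i - 1" i A B] by auto
  then have "w \<in> Espace A B i"
    using b byw subspace_diff[OF subspace_Espace, of b A B i y] by simp
  moreover have "orthogonal w (e j)" if "p j < i" for j
  proof (cases "p j = i - 1")
    case True
    then have "e j \<bullet> w = 0" using zero[OF True] e_orth[of y j] y byw by (simp add: inner_add_right)
    then show ?thesis by (simp add: orthogonal_def inner_commute)
  next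
    case False
    then have "Suc (p j) \<le> i - 1" using that by simp
    then show ?thesis using e_mem[of j] Espace_mono w by blast
  qed
  ultimately have "orthogonal w w"
    using span by (intro orthogonal_to_span[of w "e ` {j. p j < i}"]) auto
  then show ?thesis using y byw by (simp add: orthogonal_self)
qed

end

text \<open>As \<open>\<delta>\<close> tends to \<open>c0\<close>, the factor \<open>sqrt (\<delta> / c0)\<close> of the prefactor is absorbed into the \<open>O(t)\<close> of the exponent.\<close>

lemma heat_kernel_normal_form:
  fixes c0 q0 \<delta> q t :: real
  assumes "0 < t" "0 < c0" "0 < \<delta>"
  shows "exp (-(1/2) * (q / t ^ r)) / (K * sqrt (t ^ N * \<delta>)) =
    t powr (- real N / 2) / (K * sqrt c0) *
      exp (- (q0 / 2 + (q / 2 - q0 / 2 + t ^ r * (ln (\<delta> / c0) / 2))) / t ^ r)"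
proof -
  have "(t powr (- real N / 2))\<^sup>2 = inverse (t ^ N)"
  proof -
    have "(t powr (- real N / 2))\<^sup>2 = t powr (- real N)"
      by (simp add: power2_eq_square flip: powr_add)
    then show ?thesis using assms(1) by (simp add: powr_minus powr_realpow)
  qed
  then have tN: "t powr (- real N / 2) = 1 / sqrt (t ^ N)"
    using real_sqrt_unique[of "t powr (- real N / 2)" "inverse (t ^ N)"]
    by (simp add: real_sqrt_inverse inverse_eq_divide real_sqrt_divide)
  have "(exp (ln (\<delta> / c0) / 2))\<^sup>2 = \<delta> / c0"
    using assms by (simp add: power2_eq_square flip: exp_add)
  then have \<delta>: "exp (ln (\<delta> / c0) / 2) = sqrt \<delta> / sqrt c0"
    using real_sqrt_unique[of "exp (ln (\<delta> / c0) / 2)" "\<delta> / c0"] by (simp add: real_sqrt_divide)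
  have "- (q0 / 2 + (q / 2 - q0 / 2 + t ^ r * (ln (\<delta> / c0) / 2))) / t ^ r =
      -(1/2) * (q / t ^ r) - ln (\<delta> / c0) / 2"
    using assms(1) by (simp add: field_simps)
  then show ?thesis
    unfolding tN using assms by (simp add: exp_diff \<delta> real_sqrt_mult)
qed

section \<open>The expansion of the heat kernel on the diagonal\<close>

theorem theorem1p3:
  fixes A :: "real^'n^'n" and B :: "real^'k^'n" and m i :: nat and x0 :: "real^'n"
  assumes rankB: "rank B = CARD('k)"
    and m_pos: "1 \<le> m"
    and kalman: "dim (Espace A B m) = CARD('n)"
    and m_min: "\<forall>j. 1 \<le> j \<and> j < m \<longrightarrow> dim (Espace A B j) \<noteq> CARD('n)"
    and i_range: "2 \<le> i" "i \<le> m"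
    and x0: "A *v x0 \<in> Espace A B i - Espace A B (i - 1)"
  shows "\<exists>c0 C. c0 > 0 \<and> C > 0 \<and>
     ((\<lambda>t. det (Dmat A B t) / t ^ Nexp A B m) \<longlongrightarrow> c0) (at_right 0) \<and>
     (\<exists>g. g \<in> O[at_right 0](\<lambda>t. t) \<and>
        (\<forall>\<^sub>F t in at_right 0.
           heat_kernel A B t x0 x0 =
             t powr (- real (Nexp A B m) / 2) / ((2*pi) powr (real CARD('n) / 2) * sqrt c0)
             * exp (- (C + g t) / t ^ (2*i - 3))))"
proof (rule adapted_basis[of "Espace A B" m, OF subspace_Espace Espace_mono Espace_0 kalman])
  fix e :: "'n \<Rightarrow> real^'n" and p :: "'n \<Rightarrow> nat"
  assume p: "\<And>j. p j < m"
    and e: "\<And>j. e j \<in> Espace A B (Suc (p j))" "\<And>j u. u \<in> Espace A B (p j) \<Longrightarrow> e j \<bullet> u = 0"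
    and card: "\<And>r. r \<le> m \<Longrightarrow> card {j. p j < r} = dim (Espace A B r)"
    and span: "\<And>r. r \<le> m \<Longrightarrow> span (e ` {j. p j < r}) = Espace A B r"
  \<comment> \<open>By the Kalman condition the rows \<open>e j\<close> span the whole space, so a
    kernel vector is orthogonal to itself.\<close>
  have "det (\<chi> j. e j) \<noteq> 0"
  proof (rule det_nonzero_if_trivial_kernel)
    fix x assume x: "(\<chi> j. e j) *v x = 0"
    show "x = 0"
    proof -
      have "orthogonal x (e j)" for j
        using x by (simp add: vec_eq_iff matrix_vector_mult_def orthogonal_def inner_vec_def mult.commute)
      moreover have "x \<in> span (range e)"
      proof -
        have "span (Espace A B m) = Espace A B m"
          by (rule span_eq_iff[THEN iffD2, OF subspace_Espace])
        moreover have "span (Espace A B m) = UNIV"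
          using kalman dim_eq_full[of "Espace A B m"] by simp
        ultimately show ?thesis using span[of m] p by simp
      qed
      ultimately have "orthogonal x x" by (intro orthogonal_to_span[of x "range e"]) auto
      then show ?thesis by (simp add: orthogonal_self)
    qed
  qed
  then interpret adapted_frame A B e p
    using e by unfold_locales
  have N: "Nexp A B m = (\<Sum>j\<in>UNIV. 2 * p j + 1)"
    unfolding Nexp_def kdim_def by (rule sum_levels[OF p card])
  define \<delta> where "\<delta> = (\<lambda>t. det (scaled_gramian t) / (det (\<chi> j. e j) * det (mexp (-t) A))\<^sup>2)"
  define c0 where "c0 = det limit_gramian / (det (\<chi> j. e j))\<^sup>2"
  have detG0: "0 < det limit_gramian" by (rule positive_definite_det_pos[OF limit_gramian_pos])
  then have c0: "0 < c0" using det_frame by (simp add: c0_def)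
  have \<delta>: "(\<delta> \<longlongrightarrow> c0) (at_right 0)" unfolding \<delta>_def c0_def by (rule tendsto_det_ratio)
  obtain z :: "real^'n" where
    z: "\<And>j. first_order (\<lambda>t. (t ^ (i - 2) *\<^sub>R (rescaling t *v (x0 - mexp t A *v x0))) $ j) (z $ j)"
    and z_top: "\<And>j. p j = i - 1 \<Longrightarrow> z $ j = - (e j \<bullet> (A *v x0))"
    using drift_leading_term[OF i_range(1), of x0] x0 by blast
  \<comment> \<open>If \<open>z = 0\<close>, every \<open>e j\<close> of level \<open>i - 1\<close>
    is orthogonal to \<open>A *v x0\<close>, which would put \<open>A *v x0\<close> into the space
    of index \<open>i - 1\<close>.\<close>
  have "z \<noteq> 0"
  proof
    assume "z = 0"
    then have "A *v x0 \<in> Espace A B (i - 1)"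
      using i_range x0 z_top by (intro mem_Espace_pred span) auto
    then show False using x0 by simp
  qed
  \<comment> \<open>The constant \<open>C\<close> will be \<open>q0 / 2\<close>, the half coming
    from the Gaussian exponent.\<close>
  define q0 where "q0 = z \<bullet> (matrix_inv limit_gramian *v z)"
  have q0: "0 < q0"
    unfolding q0_def by (rule positive_definite_inverse_pos[OF limit_gramian_pos \<open>z \<noteq> 0\<close>])
  define \<zeta> where "\<zeta> = (\<lambda>t. t ^ (i - 2) *\<^sub>R (rescaling t *v (x0 - mexp t A *v x0)))"
  define q where "q = (\<lambda>t. \<zeta> t \<bullet> (matrix_inv (scaled_gramian t) *v \<zeta> t))"
  have q: "first_order q q0"
    unfolding q_def q0_def \<zeta>_def
    using detG0 by (intro first_order_inverse_quadratic_form first_order_scaled_gramian z) simp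
  define g where "g = (\<lambda>t. q t / 2 - q0 / 2 + t ^ (2 * i - 3) * (ln (\<delta> t / c0) / 2))"
  have g: "g \<in> O[at_right 0](\<lambda>t. t)"
  proof -
    \<comment> \<open>Because \<open>i \<ge> 2\<close>, one factor \<open>t\<close> can be split off
      \<open>t ^ (2 * i - 3)\<close>; what remains is bounded, since the logarithm tends to
      0.\<close>
    have "((\<lambda>t. t ^ (2 * i - 4) * (ln (\<delta> t / c0) / 2)) \<longlongrightarrow> 0 ^ (2 * i - 4) * (ln (c0 / c0) / 2)) (at_right 0)"
      using \<delta> c0 by (intro tendsto_intros) auto
    then have "(\<lambda>t. t ^ (2 * i - 4) * (ln (\<delta> t / c0) / 2)) \<in> O[at_right 0](\<lambda>_. 1)"
      by (intro bigoI_tendsto) auto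
    then have "(\<lambda>t. t * (t ^ (2 * i - 4) * (ln (\<delta> t / c0) / 2))) \<in> O[at_right 0](\<lambda>t. t * 1)"
      by (intro landau_o.big.mult) simp_all
    moreover have "t * t ^ (2 * i - 4) = t ^ (2 * i - 3)" for t :: real
    proof -
      have "2 * i - 3 = Suc (2 * i - 4)" using i_range by simp
      then show ?thesis by simp
    qed
    ultimately have "(\<lambda>t. t ^ (2 * i - 3) * (ln (\<delta> t / c0) / 2)) \<in> O[at_right 0](\<lambda>t. t)"
      by (simp flip: mult.assoc)
    moreover have "(\<lambda>t. (1 / 2) * (q t - q0)) \<in> O[at_right 0](\<lambda>t. t)"
      using q unfolding first_order_def by simp
    ultimately have "(\<lambda>t. (1 / 2) * (q t - q0) + t ^ (2 * i - 3) * (ln (\<delta> t / c0) / 2)) \<in> O[at_right 0](\<lambda>t. t)"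
      by (intro sum_in_bigo)
    then show ?thesis by (simp add: g_def diff_divide_distrib)
  qed
  have det: "det (Dmat A B t) = t ^ Nexp A B m * \<delta> t" if "0 < t" for t
    unfolding N \<delta>_def by (rule det_Dmat[OF that])
  \<comment> \<open>This holds as soon as \<open>\<delta> t > 0\<close>: the scaled Gramian is then
    invertible and \<open>ln (\<delta> t / c0)\<close> represents the determinant correction
    exactly.\<close>
  have "\<forall>\<^sub>F t in at_right 0. heat_kernel A B t x0 x0 =
      t powr (- real (Nexp A B m) / 2) / ((2*pi) powr (real CARD('n) / 2) * sqrt c0)
      * exp (- (q0 / 2 + g t) / t ^ (2*i - 3))"
    using eventually_pos_at_right order_tendstoD(1)[OF \<delta> c0]
  proof eventually_elim
    case (elim t)
    then have "det (scaled_gramian t) \<noteq> 0" by (auto simp: \<delta>_def)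
    from Dmat_inverse_form[OF elim(1) this i_range(1)]
    have "heat_kernel A B t x0 x0 =
        exp (-(1/2) * (q t / t ^ (2*i - 3))) / ((2*pi) powr (real CARD('n) / 2) * sqrt (t ^ Nexp A B m * \<delta> t))"
      unfolding heat_kernel_def Let_def det[OF elim(1)] q_def \<zeta>_def by simp
    then show ?case
      unfolding g_def using heat_kernel_normal_form[OF elim(1) c0 elim(2)] by simp
  qed
  moreover have "((\<lambda>t. det (Dmat A B t) / t ^ Nexp A B m) \<longlongrightarrow> c0) (at_right 0)"
  proof (rule Lim_transform_eventually[OF \<delta>])
    show "\<forall>\<^sub>F t in at_right 0. \<delta> t = det (Dmat A B t) / t ^ Nexp A B m"
      using eventually_pos_at_right by eventually_elim (simp add: det)
  qed
  ultimately show ?thesis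
    using c0 q0 g by (intro exI[of _ c0] exI[of _ "q0 / 2"]) auto
qed

end
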